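(* Let $\mathscr{F}$ be a field, let $n \geq 1$, $k \geq 1$ and $l \geq 0$ be integers, let $G \in M_n(\mathscr{F})$, let $n_1, \ldots, n_k, m_1, \ldots, m_l \in \mathbb{N}$, and let $c_1, \ldots, c_k$ be nonzero scalars in $\mathscr{F}$. Set $c = (c_1 \cdots c_k)^{-1}$. The following two statements are equivalent. 1. There exist matrices $E_1, \ldots, E_k, Z_1, \ldots, Z_l \in M_n(\mathscr{F})$ such that $G = (c_1E_1) \cdots (c_kE_k) Z_1 \cdots Z_l$, where $E_i^2 = E_i$ and $\mathrm{n}(E_i) = n_i$ for each $i \in \{1, \ldots, k\}$, and $Z_j^2 = \mathbf{0}$ and $\mathrm{n}(Z_j) = m_j$ for each $j \in \{1, \ldots, l\}$. 2. All of the following hold: (i) each of $n_1, \ldots, n_k, m_1, \ldots, m_l$ is at most $\mathrm{n}(G)$; (ii) $m_j \geq n/2$ for each $j \in \{1, \ldots, l\}$; (iii) furthermore, if $l = 0$ then $\mathrm{r}(I - cG) \leq n_1 + \cdots + n_k$; if $l = 1$ then $\dim(\mathrm{R}(G) + \mathrm{N}(G)) \leq n_1 + \cdots + n_k + m_1$; if $l = 2$ then $\mathrm{r}(G) \leq n_1 + \cdots + n_k + \mathrm{n}_0(G)$ (and if $l \geq 3$, condition (iii) imposes nothing).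
   Context: $M_n(\mathscr{F})$ is the set of $n \times n$ matrices over the field $\mathscr{F}$, $I$ is the identity matrix, and $\mathbb{N}$ denotes the non-negative integers. When $l = 0$ there are no factors $Z_j$ and no numbers $m_j$. For $G \in M_n(\mathscr{F})$, $\mathrm{N}(G)$ is the null space and $\mathrm{R}(G)$ the range (column space) of $G$, as subspaces of $\mathscr{F}^n$; $\mathrm{n}(G) = \dim \mathrm{N}(G)$ is the nullity and $\mathrm{r}(G) = \dim \mathrm{R}(G)$ is the rank. Define $\mathrm{n}_0(G) = \mathrm{n}(G) - \dim(\mathrm{R}(G) \cap \mathrm{N}(G))$. *)

theory Defs
  imports "HOL-Analysis.Analysis"
begin

definition null_space :: "'a::field^'n^'m \<Rightarrow> ('a^'n) set"
  where "null_space A = {x. A *v x = 0}"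

definition col_space :: "'a::field^'n^'m \<Rightarrow> ('a^'m) set"
  where "col_space A = range (\<lambda>x. A *v x)"

definition nullity :: "'a::field^'n^'m \<Rightarrow> nat"
  where "nullity A = vec.dim (null_space A)"

(* The library's rank is by definition the row rank. *)
definition col_rank :: "'a::field^'n^'m \<Rightarrow> nat"
  where "col_rank A = vec.dim (col_space A)"

(* The subtraction is never truncated: the intersection lies in the null space. *)
definition nullity0 :: "'a::field^'n^'n \<Rightarrow> nat"
  where "nullity0 A = nullity A - vec.dim (col_space A \<inter> null_space A)"

(* ( * ) and ( ^ ) on 'a^'n^'n are entrywise, hence a separate ordered product
   A_1 ** ... ** A_r for ( ** ); the empty product is the identity. *)
definition mat_prod_list :: "('a::semiring_1^'n^'n) list \<Rightarrow> 'a^'n^'n"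
  where "mat_prod_list As = foldr (**) As (mat 1)"

definition mat_scale :: "'a::semiring_1 \<Rightarrow> 'a^'n^'m \<Rightarrow> 'a^'n^'m"
  where "mat_scale c A = (\<chi> i j. c * A $ i $ j)"

end

theory Submission
  imports Defs
begin

text \<open>
  Write \<open>R\<close> and \<open>N\<close> for the column and null spaces. The scalars \<open>c\<^sub>i\<close> can be collected
  into one and moved to the left-hand side, and \<open>c G\<close> has the same \<open>R\<close> and \<open>N\<close> as \<open>G\<close>, so
  the question is about \<open>H = P ** Q\<close> with \<open>P\<close> a product of idempotents and \<open>Q\<close> a product of
  square-zero matrices.

  Two facts separate the roles of the factors. First, \<open>P\<close> enters only through its nullity and
  through the rank of \<open>I - P\<close>: \<open>P\<close> is a product of idempotents of nullities \<open>n\<^sub>1, ..., n\<^sub>k\<close> iff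
  every \<open>n\<^sub>i\<close> is at most the nullity of \<open>P\<close> and the rank of \<open>I - P\<close> is at most their sum
  (\<open>is_product_idempotent_iff\<close>). Hence an idempotent of any nullity \<open>p\<close> between the maximum and
  the sum of the \<open>n\<^sub>i\<close> is such a product, and for sufficiency one may take \<open>P\<close> itself
  idempotent as soon as a square-zero factor is present. Second, \<open>G = E ** G'\<close> for an idempotent
  \<open>E\<close> of nullity \<open>p\<close> whenever \<open>G' - G\<close> maps into a subspace of dimension at most \<open>p\<close> that
  meets \<open>R G\<close> trivially and \<open>p\<close> is at most the nullity of \<open>G\<close>
  (\<open>exists_idempotent_nullity\<close>). Splitting off an idempotent thus means perturbing \<open>G\<close> in
  directions transversal to its range, and every sufficiency proof chooses such a perturbation well:
  \<open>split_off_idempotent\<close> makes \<open>I - G'\<close> smaller,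
  \<open>idempotent_square_zero_factorization\<close> makes \<open>G'\<close> square-zero, and
  \<open>split_off_idempotent_raising_dim\<close> pushes \<open>R G'\<close> out of \<open>N G'\<close>.

  With at least two square-zero factors, the only obstruction beyond the bounds on the nullities
  arises when there are exactly two: \<open>G = Z1 ** Z2\<close> needs a space of dimension \<open>rank G\<close> inside \<open>N G\<close> that avoids \<open>R G\<close>
  (the part of \<open>R Z2\<close> which \<open>Z1\<close> maps onto \<open>R G\<close>), and this is enough
  (\<open>exists_two_square_zero_factors\<close>). A further square-zero factor on the left frees the
  intermediate range to be transversal to \<open>N G\<close>, so that the obstruction disappears
  (\<open>split_off_square_zero\<close>).

  All constructions choose subspaces of prescribed dimension that contain one given subspace and
  meet at most two others trivially. This is possible over every field, because a vector space is never
  the union of two proper subspaces; \<open>extend_avoiding_two_subspaces\<close> is the common form.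
  Necessity is dimension counting: \<open>dim_le_of_product_one_square_zero\<close> and
  \<open>rank_le_of_product_two_square_zero\<close>.
\<close>

section \<open>Subspaces in general position\<close>

definition subspace_sum :: "('a::field^'n) set \<Rightarrow> ('a^'n) set \<Rightarrow> ('a^'n) set"
    (infixl "\<^bold>+" 65)
  where "A \<^bold>+ B = {x + y | x y. x \<in> A \<and> y \<in> B}"

lemma subspace_sumI: "x \<in> A \<Longrightarrow> y \<in> B \<Longrightarrow> x + y \<in> A \<^bold>+ B"
  unfolding subspace_sum_def by blast

lemma subspace_sumE:
  assumes "z \<in> A \<^bold>+ B"
  obtains x y where "x \<in> A" "y \<in> B" "z = x + y"
  using assms unfolding subspace_sum_def by blast

lemma subspace_subspace_sum [simp, intro]:
  "vec.subspace A \<Longrightarrow> vec.subspace B \<Longrightarrow> vec.subspace (A \<^bold>+ B)"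
  unfolding subspace_sum_def by (rule vec.subspace_sums)

lemma subset_subspace_sum1: "vec.subspace B \<Longrightarrow> A \<subseteq> A \<^bold>+ B"
  by (metis add.right_neutral subsetI subspace_sumI vec.subspace_0)

lemma subset_subspace_sum2: "vec.subspace A \<Longrightarrow> B \<subseteq> A \<^bold>+ B"
  by (metis add.left_neutral subsetI subspace_sumI vec.subspace_0)

lemma subspace_sum_least:
  "vec.subspace C \<Longrightarrow> A \<subseteq> C \<Longrightarrow> B \<subseteq> C \<Longrightarrow> A \<^bold>+ B \<subseteq> C"
  by (auto elim!: subspace_sumE intro: vec.subspace_add)

lemma dim_subspace_sum:
  "vec.subspace A \<Longrightarrow> vec.subspace B \<Longrightarrow>
    vec.dim (A \<^bold>+ B) + vec.dim (A \<inter> B) = vec.dim A + vec.dim B"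
  unfolding subspace_sum_def by (rule vec.dim_sums_Int)

lemma dim_subspace_sum_direct:
  assumes "vec.subspace A" "vec.subspace B" "A \<inter> B \<subseteq> {0}"
  shows "vec.dim (A \<^bold>+ B) = vec.dim A + vec.dim B"
proof -
  have "vec.dim (A \<inter> B) = 0"
    using assms(3) by (metis vec.dim_eq_0)
  then show ?thesis
    using dim_subspace_sum[OF assms(1,2)] by linarith
qed

lemma dim_subspace_sum_le:
  "vec.subspace A \<Longrightarrow> vec.subspace B \<Longrightarrow> vec.dim (A \<^bold>+ B) \<le> vec.dim A + vec.dim B"
  using dim_subspace_sum[of A B] by linarith

lemma dim_le_CARD: "vec.dim (A :: ('a::field^'n) set) \<le> CARD('n)"
  by (rule dim_subset_UNIV_cart_gen)

text \<open>If \<open>x\<close> escapes \<open>P\<close> and \<open>y\<close> escapes \<open>Q\<close>, one of \<open>x\<close>, \<open>y\<close>, \<open>x + y\<close> escapes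
  both. With three subspaces this fails over the field with two elements, which is why all later
  choices avoid at most two subspaces at a time.\<close>

lemma exists_outside_two_subspaces:
  fixes S :: "('a::field^'n) set"
  assumes S: "vec.subspace S" and P: "vec.subspace P" and Q: "vec.subspace Q"
    and "\<not> S \<subseteq> P" "\<not> S \<subseteq> Q"
  obtains v where "v \<in> S" "v \<notin> P" "v \<notin> Q"
proof -
  obtain x y where x: "x \<in> S" "x \<notin> P" and y: "y \<in> S" "y \<notin> Q"
    using assms by blast
  have "x + y \<in> S" "x + y \<in> P \<Longrightarrow> y \<in> P \<Longrightarrow> False" "x + y \<in> Q \<Longrightarrow> x \<in> Q \<Longrightarrow> False"
    using x y vec.subspace_add[OF S] vec.subspace_diff[OF P, of "x+y" y]
      vec.subspace_diff[OF Q, of "x+y" x] by auto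
  then show thesis
    using that x y by blast
qed

text \<open>\<open>K0\<close> grows by one vector at a time: a vector of \<open>S\<close> outside \<open>(A \<inter> S) \<^bold>+ K\<close> and
  \<open>(B \<inter> S) \<^bold>+ K\<close> can be added to \<open>K\<close> without creating an intersection with \<open>A\<close> or \<open>B\<close>, and the
  dimension bounds keep both sums proper in \<open>S\<close> until the dimension \<open>k\<close> is reached.\<close>

lemma extend_avoiding_two_subspaces:
  fixes S :: "('a::field^'n) set"
  assumes S: "vec.subspace S" and A: "vec.subspace A" and B: "vec.subspace B"
    and K0: "vec.subspace K0" "K0 \<subseteq> S" "K0 \<inter> A \<subseteq> {0}" "K0 \<inter> B \<subseteq> {0}"
    and k: "vec.dim K0 \<le> k" "vec.dim (A \<inter> S) + k \<le> vec.dim S" "vec.dim (B \<inter> S) + k \<le> vec.dim S"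
  obtains K where "vec.subspace K" "K0 \<subseteq> K" "K \<subseteq> S" "vec.dim K = k"
    "K \<inter> A \<subseteq> {0}" "K \<inter> B \<subseteq> {0}"
proof -
  have "\<exists>K. vec.subspace K \<and> K0 \<subseteq> K \<and> K \<subseteq> S \<and> vec.dim K = k \<and> K \<inter> A \<subseteq> {0} \<and> K \<inter> B \<subseteq> {0}"
    using k
  proof (induction k rule: dec_induct)
    case base
    then show ?case using K0 by blast
  next
    case (step k)
    then obtain K where K: "vec.subspace K" "K0 \<subseteq> K" "K \<subseteq> S" "vec.dim K = k"
      "K \<inter> A \<subseteq> {0}" "K \<inter> B \<subseteq> {0}" by auto
    have proper: "\<not> S \<subseteq> (C \<inter> S) \<^bold>+ K"
      if C: "vec.subspace C" "vec.dim (C \<inter> S) + Suc k \<le> vec.dim S" for C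
    proof
      assume "S \<subseteq> (C \<inter> S) \<^bold>+ K"
      then have "vec.dim S \<le> vec.dim ((C \<inter> S) \<^bold>+ K)" by (rule vec.dim_subset)
      also have "\<dots> \<le> vec.dim (C \<inter> S) + k"
        using dim_subspace_sum_le[of "C \<inter> S" K] C(1) S K by (simp add: vec.subspace_inter)
      finally show False using C(2) by simp
    qed
    obtain v where v: "v \<in> S" "v \<notin> (A \<inter> S) \<^bold>+ K" "v \<notin> (B \<inter> S) \<^bold>+ K"
      using exists_outside_two_subspaces[OF S _ _ proper proper] A B S K(1) step.prems
      by (metis subspace_subspace_sum vec.subspace_inter)
    define K' where "K' = vec.span (insert v K)"
    have vK: "v \<notin> K"
      using v(2) subset_subspace_sum2[of "A \<inter> S" K] A S by (auto simp: vec.subspace_inter)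
    have K'_el: "\<exists>c. x - c *s v \<in> K" if "x \<in> K'" for x
      using that vec.span_breakdown_eq[of x v K] K(1) by (simp add: K'_def vec.span_eq_iff[THEN iffD2])
    have avoid: "K' \<inter> C \<subseteq> {0}"
      if C: "vec.subspace C" "K \<inter> C \<subseteq> {0}" "v \<notin> (C \<inter> S) \<^bold>+ K" for C
    proof
      fix x assume x: "x \<in> K' \<inter> C"
      then obtain c where c: "x - c *s v \<in> K" using K'_el by blast
      have xS: "x \<in> S"
      proof -
        have "x = (x - c *s v) + c *s v" by simp
        then show ?thesis
          using c K(3) v(1) vec.subspace_add[OF S] vec.subspace_scale[OF S] by (metis subsetD)
      qed
      show "x \<in> {0}"
      proof (cases "c = 0")
        case True
        then show ?thesis using c x C(2) by auto
      next
        case False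
        have "v = inverse c *s x + (- inverse c) *s (x - c *s v)"
          using False by (simp add: vec.scale_right_diff_distrib)
        moreover have "inverse c *s x \<in> C \<inter> S"
          using x xS C(1) S vec.subspace_scale by blast
        moreover have "(- inverse c) *s (x - c *s v) \<in> K"
          using c K(1) vec.subspace_scale by blast
        ultimately have "v \<in> (C \<inter> S) \<^bold>+ K" by (metis subspace_sumI)
        then show ?thesis using C(3) by blast
      qed
    qed
    have "vec.dim K' = Suc k"
      using vK K(1,4) by (simp add: K'_def vec.dim_insert vec.span_eq_iff[THEN iffD2])
    moreover have "K' \<subseteq> S"
      unfolding K'_def using v(1) K(3) S by (simp add: vec.span_minimal)
    moreover have "K0 \<subseteq> K'"
      unfolding K'_def using K(2) vec.span_superset[of "insert v K"] by auto
    ultimately show ?case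
      using avoid[OF A K(5) v(2)] avoid[OF B K(6) v(3)] by (metis K'_def vec.subspace_span)
  qed
  then show thesis by (elim exE conjE) (rule that)
qed

lemma extend_avoiding:
  fixes S :: "('a::field^'n) set"
  assumes "vec.subspace S" "vec.subspace A"
    and "vec.subspace K0" "K0 \<subseteq> S" "K0 \<inter> A \<subseteq> {0}"
    and "vec.dim K0 \<le> k" "vec.dim (A \<inter> S) + k \<le> vec.dim S"
  obtains K where "vec.subspace K" "K0 \<subseteq> K" "K \<subseteq> S" "vec.dim K = k" "K \<inter> A \<subseteq> {0}"
  by (rule extend_avoiding_two_subspaces[OF assms(1,2,2,3,4,5,5,6,7,7)]) (rule that)

lemma avoiding_two_subspaces:
  fixes S :: "('a::field^'n) set"
  assumes S: "vec.subspace S" and "vec.subspace A" "vec.subspace B"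
    and k: "vec.dim (A \<inter> S) + k \<le> vec.dim S" "vec.dim (B \<inter> S) + k \<le> vec.dim S"
  obtains K where "vec.subspace K" "K \<subseteq> S" "vec.dim K = k" "K \<inter> A \<subseteq> {0}" "K \<inter> B \<subseteq> {0}"
proof (rule extend_avoiding_two_subspaces[OF assms(1-3) vec.subspace_single_0 _ _ _ _ k])
  show "{0} \<subseteq> S" using vec.subspace_0[OF S] by simp
qed (use that in auto)

lemma avoiding_subspace:
  fixes S :: "('a::field^'n) set"
  assumes "vec.subspace S" "vec.subspace A" "vec.dim (A \<inter> S) + k \<le> vec.dim S"
  obtains K where "vec.subspace K" "K \<subseteq> S" "vec.dim K = k" "K \<inter> A \<subseteq> {0}"
  by (rule avoiding_two_subspaces[OF assms(1,2,2,3,3)]) (rule that)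

lemma intermediate_subspace:
  fixes S :: "('a::field^'n) set"
  assumes "vec.subspace S" "vec.subspace K0" "K0 \<subseteq> S" "vec.dim K0 \<le> k" "k \<le> vec.dim S"
  obtains K where "vec.subspace K" "K0 \<subseteq> K" "K \<subseteq> S" "vec.dim K = k"
proof (rule extend_avoiding[OF assms(1) vec.subspace_single_0 assms(2,3) _ assms(4)])
  have "vec.dim ({0} \<inter> S) = 0" by (simp only: vec.dim_eq_0) blast
  then show "vec.dim ({0} \<inter> S) + k \<le> vec.dim S" using assms(5) by linarith
qed (use that in auto)

lemma complement_extending:
  fixes S :: "('a::field^'n) set"
  assumes S: "vec.subspace S" and A: "vec.subspace A" "A \<subseteq> S"
    and K0: "vec.subspace K0" "K0 \<subseteq> S" "K0 \<inter> A \<subseteq> {0}"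
  obtains K where "vec.subspace K" "K0 \<subseteq> K" "K \<inter> A \<subseteq> {0}" "K \<^bold>+ A = S"
    "vec.dim K + vec.dim A = vec.dim S"
proof -
  have "vec.dim (K0 \<^bold>+ A) \<le> vec.dim S"
    using subspace_sum_least[OF S K0(2) A(2)] by (rule vec.dim_subset)
  then have le: "vec.dim K0 + vec.dim A \<le> vec.dim S"
    using dim_subspace_sum_direct[OF K0(1) A(1) K0(3)] by simp
  have AS: "A \<inter> S = A" using A(2) by blast
  have "vec.dim K0 \<le> vec.dim S - vec.dim A" "vec.dim (A \<inter> S) + (vec.dim S - vec.dim A) \<le> vec.dim S"
    unfolding AS using le by linarith+
  then obtain K where K: "vec.subspace K" "K0 \<subseteq> K" "K \<subseteq> S" "vec.dim K = vec.dim S - vec.dim A"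
      "K \<inter> A \<subseteq> {0}"
    by (rule extend_avoiding[OF S A(1) K0])
  have "K \<^bold>+ A = S"
  proof (rule vec.subspace_dim_equal)
    show "vec.dim S \<le> vec.dim (K \<^bold>+ A)"
      using dim_subspace_sum_direct[OF K(1) A(1) K(5)] K(4) by simp
  qed (use K A S in \<open>auto intro: subspace_sum_least[THEN subsetD]\<close>)
  then show thesis
    using that K le by simp
qed

lemma complement:
  fixes S :: "('a::field^'n) set"
  assumes "vec.subspace S" "vec.subspace A" "A \<subseteq> S"
  obtains K where "vec.subspace K" "K \<inter> A \<subseteq> {0}" "K \<^bold>+ A = S"
    "vec.dim K + vec.dim A = vec.dim S"
proof (rule complement_extending[OF assms vec.subspace_single_0])
  show "{0} \<subseteq> S" using vec.subspace_0[OF assms(1)] by simp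
qed (use that in auto)

section \<open>Matrices with prescribed null space\<close>

lemma subspace_null_space [simp, intro]: "vec.subspace (null_space A)"
  unfolding null_space_def vec.subspace_def
  by (simp add: matrix_vector_right_distrib vector_scalar_commute)

lemma subspace_image [simp, intro]: "vec.subspace S \<Longrightarrow> vec.subspace ((*v) A ` S)"
  by (rule vec.subspace_image)

lemma subspace_col_space [simp, intro]: "vec.subspace (col_space A)"
  unfolding col_space_def by (rule vec.subspace_image) simp

lemma in_null_space: "x \<in> null_space A \<longleftrightarrow> A *v x = 0"
  by (simp add: null_space_def)

lemma in_col_space [simp, intro]: "A *v x \<in> col_space A"
  by (simp add: col_space_def)

text \<open>Rank-nullity for the restriction of \<open>A\<close> to \<open>S\<close>.\<close>

lemma dim_image_Int_null_space:
  assumes S: "vec.subspace S"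
  shows "vec.dim ((*v) A ` S) + vec.dim (S \<inter> null_space A) = vec.dim S"
proof -
  have "vec.subspace (S \<inter> null_space A)" using S by (simp add: vec.subspace_inter)
  then obtain T where T: "vec.subspace T" "T \<inter> (S \<inter> null_space A) \<subseteq> {0}"
    "T \<^bold>+ (S \<inter> null_space A) = S" "vec.dim T + vec.dim (S \<inter> null_space A) = vec.dim S"
    using complement[OF S, of "S \<inter> null_space A"] by blast
  have TS: "T \<subseteq> S"
    using T(3) subset_subspace_sum1 \<open>vec.subspace (S \<inter> null_space A)\<close> by blast
  have "inj_on ((*v) A) T"
  proof (rule inj_onI)
    fix x y assume xy: "x \<in> T" "y \<in> T" "A *v x = A *v y"
    then have "x - y \<in> T \<inter> (S \<inter> null_space A)"
      using TS vec.subspace_diff[OF T(1)] by (auto simp: in_null_space matrix_vector_mult_diff_distrib)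
    then show "x = y" using T(2) by auto
  qed
  then have "vec.dim ((*v) A ` T) = vec.dim T"
    using T(1) by (intro vec.dim_image_eq) (auto simp: vec.span_eq_iff[THEN iffD2])
  moreover have "(*v) A ` S = (*v) A ` T"
  proof
    show "(*v) A ` S \<subseteq> (*v) A ` T"
    proof (rule image_subsetI)
      fix x assume "x \<in> S"
      then obtain t z where "t \<in> T" "z \<in> null_space A" "x = t + z"
        using T(3) by (metis IntD2 subspace_sumE)
      then show "A *v x \<in> (*v) A ` T"
        by (simp add: matrix_vector_right_distrib in_null_space)
    qed
  qed (use TS in blast)
  ultimately show ?thesis using T(4) by simp
qed

lemma col_rank_plus_nullity: "col_rank A + nullity A = CARD('n)"
  for A :: "'a::field^'n^'m"
  using dim_image_Int_null_space[OF vec.subspace_UNIV, of A]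
  by (simp add: col_rank_def nullity_def col_space_def vec_dim_card del: vec.dim_UNIV)

text \<open>The idempotent is the projection along \<open>K\<close> onto a complement of \<open>K\<close> that contains \<open>R\<close>.\<close>

lemma exists_idempotent:
  fixes K R :: "('a::field^'n) set"
  assumes K: "vec.subspace K" and R: "vec.subspace R" and KR: "K \<inter> R \<subseteq> {0}"
  obtains E :: "'a^'n^'n"
  where "E ** E = E" "null_space E = K" "\<And>x. x \<in> R \<Longrightarrow> E *v x = x"
proof -
  obtain C where C: "vec.subspace C" "R \<subseteq> C" "C \<inter> K \<subseteq> {0}" "C \<^bold>+ K = UNIV"
    using complement_extending[OF vec.subspace_UNIV K _ R] KR by (metis Int_commute subset_UNIV)
  define f where "f x = (SOME r. r \<in> C \<and> x - r \<in> K)" for x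
  have f: "f x \<in> C \<and> x - f x \<in> K" for x
  proof -
    obtain r y where "r \<in> C" "y \<in> K" "x = r + y"
      using C(4) by (metis UNIV_I subspace_sumE)
    then have "r \<in> C \<and> x - r \<in> K" by simp
    then show ?thesis unfolding f_def by (rule someI)
  qed
  have uniq: "r = f x" if "r \<in> C" "x - r \<in> K" for r x
  proof -
    have "r - f x \<in> C" using that f vec.subspace_diff[OF C(1)] by blast
    moreover have "r - f x = (x - f x) - (x - r)" by simp
    then have "r - f x \<in> K" using that f vec.subspace_diff[OF K] by metis
    ultimately show ?thesis using C(3) by auto
  qed
  have lin: "Vector_Spaces.linear (*s) (*s) f"
  proof (unfold_locales)
    fix x y c
    have "(x - f x) + (y - f y) \<in> K" using f vec.subspace_add[OF K] by blast
    then have "(x + y) - (f x + f y) \<in> K" by (simp add: algebra_simps)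
    then show "f (x + y) = f x + f y"
      using uniq[of "f x + f y" "x + y"] f vec.subspace_add[OF C(1)] by metis
    have "c *s (x - f x) \<in> K" using f vec.subspace_scale[OF K] by blast
    then have "c *s x - c *s f x \<in> K" by (simp add: vec.scale_right_diff_distrib)
    then show "f (c *s x) = c *s f x"
      using uniq[of "c *s f x" "c *s x"] f vec.subspace_scale[OF C(1)] by metis
  qed
  define E where "E = matrix f"
  have E: "E *v x = f x" for x unfolding E_def by (rule matrix_works[OF lin])
  have fC: "f x = x" if "x \<in> C" for x
    using uniq[of x x] that vec.subspace_0[OF K] by simp
  show thesis
  proof (rule that)
    show "E ** E = E"
      unfolding matrix_eq matrix_vector_mul_assoc[symmetric] E using f fC by blast
    have "f x = 0 \<longleftrightarrow> x \<in> K" for x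
      using f[of x] uniq[of 0 x] vec.subspace_0[OF C(1)] by auto
    then show "null_space E = K"
      by (auto simp: null_space_def E)
    show "\<And>x. x \<in> R \<Longrightarrow> E *v x = x"
      using C(2) fC E by auto
  qed
qed

text \<open>Project along \<open>U\<close> onto a complement, which the dimension bound allows to be embedded into
  \<open>W\<close>.\<close>

lemma exists_matrix_null_space:
  fixes U :: "('a::field^'n) set" and W :: "('a^'m) set"
  assumes U: "vec.subspace U" and W: "vec.subspace W" and le: "CARD('n) \<le> vec.dim U + vec.dim W"
  obtains H :: "'a^'n^'m" where "null_space H = U" "col_space H \<subseteq> W"
proof -
  obtain C where C: "vec.subspace C" "C \<inter> U \<subseteq> {0}" "C \<^bold>+ U = UNIV" "vec.dim C + vec.dim U = CARD('n)"
    using complement[OF vec.subspace_UNIV U] by (metis subset_UNIV vec_dim_card)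
  obtain P :: "'a^'n^'n" where P: "P ** P = P" "null_space P = U" "\<And>x. x \<in> C \<Longrightarrow> P *v x = x"
    using exists_idempotent[OF U C(1)] C(2) by (metis Int_commute)
  obtain W' where W': "vec.subspace W'" "W' \<subseteq> W" "vec.dim W' = vec.dim C"
    using vec.choose_subspace_of_subspace[of "vec.dim C" W] C(4) le W
    by (metis add.commute add_le_cancel_left vec.span_eq_iff)
  obtain f where f: "Vector_Spaces.linear (*s) (*s) f" "f ` C = W'" "inj_on f C"
    using vec.subspace_isomorphism[OF C(1) W'(1)] W'(3) by metis
  interpret f: Vector_Spaces.linear "(*s)" "(*s)" f by (rule f(1))
  define H where "H = matrix f ** P"
  have H: "H *v x = f (P *v x)" for x
    unfolding H_def matrix_vector_mul_assoc[symmetric] by (rule matrix_works[OF f(1)])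
  have PC: "P *v x \<in> C" for x
  proof -
    obtain r y where "r \<in> C" "y \<in> U" "x = r + y" using C(3) by (metis UNIV_I subspace_sumE)
    then show ?thesis using P(3) P(2)[symmetric] by (simp add: matrix_vector_right_distrib in_null_space)
  qed
  have "f y = 0 \<longleftrightarrow> y = 0" if "y \<in> C" for y
    using f(3) that vec.subspace_0[OF C(1)] f.zero by (metis inj_onD)
  then have "null_space H = U"
    using PC P(2) by (auto simp: null_space_def H)
  moreover have "col_space H \<subseteq> W"
    using PC f(2) W'(2) by (auto simp: col_space_def H)
  ultimately show thesis using that by blast
qed


section \<open>Products of idempotent matrices\<close>

lemmas matrix_action_simps =
  matrix_vector_mul_assoc[symmetric] matrix_vector_mult_add_rdistrib
  matrix_vector_mult_diff_rdistrib matrix_vector_right_distrib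
  matrix_vector_mult_diff_distrib

definition idempotent_nullity :: "'a::field^'n^'n \<Rightarrow> nat \<Rightarrow> bool"
  where "idempotent_nullity E n \<longleftrightarrow> E ** E = E \<and> nullity E = n"

definition square_zero_nullity :: "'a::field^'n^'n \<Rightarrow> nat \<Rightarrow> bool"
  where "square_zero_nullity Z m \<longleftrightarrow> Z ** Z = 0 \<and> nullity Z = m"

text \<open>The constraint \<open>Q\<close> is a parameter so that one induction on the list of nullities serves
  idempotent and square-zero factors alike.\<close>

definition is_product :: "('a::field^'n^'n \<Rightarrow> nat \<Rightarrow> bool) \<Rightarrow> nat list \<Rightarrow> 'a^'n^'n \<Rightarrow> bool"
  where "is_product Q ns A \<longleftrightarrow> (\<exists>As. A = mat_prod_list As \<and> list_all2 Q As ns)"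

lemma is_product_Nil: "is_product Q [] A \<longleftrightarrow> A = mat 1"
  by (simp add: is_product_def mat_prod_list_def)

lemma is_product_Cons:
  "is_product Q (n # ns) A \<longleftrightarrow> (\<exists>E A'. A = E ** A' \<and> Q E n \<and> is_product Q ns A')"
proof
  assume "is_product Q (n # ns) A"
  then obtain E As where "A = mat_prod_list (E # As)" "Q E n" "list_all2 Q As ns"
    by (auto simp: is_product_def list_all2_Cons2)
  then show "\<exists>E A'. A = E ** A' \<and> Q E n \<and> is_product Q ns A'"
    by (auto simp: is_product_def mat_prod_list_def)
next
  assume "\<exists>E A'. A = E ** A' \<and> Q E n \<and> is_product Q ns A'"
  then obtain E As where "A = E ** mat_prod_list As" "Q E n" "list_all2 Q As ns"
    by (auto simp: is_product_def)
  then have "A = mat_prod_list (E # As) \<and> list_all2 Q (E # As) (n # ns)"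
    by (simp add: mat_prod_list_def)
  then show "is_product Q (n # ns) A"
    unfolding is_product_def by blast
qed

lemma null_space_mult: "null_space B \<subseteq> null_space (A ** B)"
  by (auto simp: in_null_space matrix_action_simps)

lemma nullity_mult_right: "nullity B \<le> nullity (A ** B)"
  unfolding nullity_def by (rule vec.dim_subset[OF null_space_mult])

lemma nullity_mult_left: "nullity A \<le> nullity (A ** B)"
  for A B :: "'a::field^'n^'n"
proof -
  have "col_space (A ** B) \<subseteq> col_space A"
    by (auto simp: col_space_def matrix_action_simps)
  then have "col_rank (A ** B) \<le> col_rank A"
    unfolding col_rank_def by (rule vec.dim_subset)
  then show ?thesis
    using col_rank_plus_nullity[of A] col_rank_plus_nullity[of "A ** B"] by linarith
qed

lemma nullity_factor_le:
  assumes "is_product Q ns A" "n \<in> set ns" "\<And>E n. Q E n \<Longrightarrow> nullity E = n"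
  shows "n \<le> nullity A"
  using assms(1,2)
proof (induction ns arbitrary: A)
  case (Cons k ns)
  then obtain E A' where A: "A = E ** A'" "Q E k" "is_product Q ns A'"
    by (auto simp: is_product_Cons)
  show ?case
  proof (cases "n = k")
    case True
    then show ?thesis using A assms(3) nullity_mult_left[of E A'] by simp
  next
    case False
    then have "n \<le> nullity A'" using Cons A(3) by simp
    then show ?thesis using A(1) nullity_mult_right[of A' E] by simp
  qed
qed simp

text \<open>On its null space, \<open>H\<close> agrees with \<open>0\<close>, so \<open>mat 1 - H\<close> agrees with the identity.\<close>

lemma null_space_subset_col_space_one_minus: "null_space H \<subseteq> col_space (mat 1 - H)"
proof
  fix x assume "x \<in> null_space H"
  then have "x = (mat 1 - H) *v x" by (simp add: in_null_space matrix_action_simps)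
  then show "x \<in> col_space (mat 1 - H)" by (metis in_col_space)
qed

lemma col_rank_one_minus_idempotent:
  assumes "E ** E = E"
  shows "col_rank (mat 1 - E) = nullity E"
proof -
  have "E *v (x - E *v x) = 0" for x
    using assms by (simp add: matrix_vector_mult_diff_distrib matrix_vector_mul_assoc)
  then have "col_space (mat 1 - E) \<subseteq> null_space E"
    by (auto simp: col_space_def in_null_space matrix_vector_mult_diff_rdistrib)
  then show ?thesis
    using null_space_subset_col_space_one_minus[of E] by (simp add: col_rank_def nullity_def)
qed

text \<open>From \<open>1 - A B = (1 - A) B + (1 - B)\<close>.\<close>

lemma col_rank_one_minus_mult:
  fixes A B :: "'a::field^'n^'n"
  shows "col_rank (mat 1 - A ** B) \<le> col_rank (mat 1 - A) + col_rank (mat 1 - B)"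
proof -
  have "col_space (mat 1 - A ** B) \<subseteq> col_space (mat 1 - A) \<^bold>+ col_space (mat 1 - B)"
  proof
    fix y assume "y \<in> col_space (mat 1 - A ** B)"
    then obtain x where "y = (mat 1 - A ** B) *v x" by (auto simp: col_space_def)
    then have "y = (mat 1 - A) *v (B *v x) + (mat 1 - B) *v x"
      by (simp add: matrix_action_simps)
    then show "y \<in> col_space (mat 1 - A) \<^bold>+ col_space (mat 1 - B)"
      by (metis subspace_sumI in_col_space)
  qed
  then have "vec.dim (col_space (mat 1 - A ** B)) \<le> vec.dim (col_space (mat 1 - A) \<^bold>+ col_space (mat 1 - B))"
    by (rule vec.dim_subset)
  also have "\<dots> \<le> col_rank (mat 1 - A) + col_rank (mat 1 - B)"
    unfolding col_rank_def by (rule dim_subspace_sum_le) auto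
  finally show ?thesis unfolding col_rank_def .
qed

text \<open>This is how idempotents are split off: if \<open>G' = G + X\<close> where \<open>X\<close> maps into \<open>K\<close>, then
  \<open>E ** G' = G\<close>. The kernel of \<open>E\<close> is \<open>K\<close> enlarged to dimension \<open>p\<close> while still avoiding
  \<open>col_space G\<close>, for which there is room because \<open>p\<close> is at most the codimension of that
  space.\<close>

lemma exists_idempotent_nullity:
  fixes G :: "'a::field^'n^'n"
  assumes K: "vec.subspace K" "K \<inter> col_space G \<subseteq> {0}"
    and p: "vec.dim K \<le> p" "p \<le> nullity G"
  obtains E where "idempotent_nullity E p" "E ** G = G" "\<And>x. x \<in> K \<Longrightarrow> E *v x = 0"
proof -
  have "vec.dim (col_space G \<inter> UNIV) + p \<le> vec.dim (UNIV :: ('a^'n) set)"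
    using p(2) col_rank_plus_nullity[of G] unfolding col_rank_def vec_dim_card by simp
  then obtain K1 where K1: "vec.subspace K1" "K \<subseteq> K1" "vec.dim K1 = p" "K1 \<inter> col_space G \<subseteq> {0}"
    using extend_avoiding[OF vec.subspace_UNIV subspace_col_space K(1) subset_UNIV K(2) p(1)] by metis
  obtain E where E: "E ** E = E" "null_space E = K1" "\<And>x. x \<in> col_space G \<Longrightarrow> E *v x = x"
    using exists_idempotent[OF K1(1) subspace_col_space K1(4)] by metis
  show thesis
  proof (rule that)
    show "idempotent_nullity E p" using E K1(3) by (simp add: idempotent_nullity_def nullity_def)
    show "E ** G = G" using E(3) by (simp add: matrix_eq matrix_vector_mul_assoc[symmetric])
    show "\<And>x. x \<in> K \<Longrightarrow> E *v x = 0" using K1(2) E(2) by (auto simp: in_null_space)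
  qed
qed

text \<open>The inductive step for products of idempotents: \<open>n\<close> is the nullity to be split off, \<open>s\<close> the
  sum of the remaining ones and \<open>M\<close> a bound for each of them. For a projection \<open>1 - F\<close> onto some
  \<open>K \<subseteq> S\<close>, where \<open>S\<close> is the column space of \<open>1 - H\<close>, the matrix \<open>H' = H + (1 - F)(1 - H)\<close>
  satisfies \<open>1 - H' = F (1 - H)\<close>, so that the rank drops by the dimension of \<open>K\<close>. Three demands
  on \<open>K\<close> compete: it should be large, avoid \<open>col_space H\<close> (then \<open>H = E ** H'\<close>), and avoid an
  \<open>M\<close>-dimensional part \<open>W\<close> of the null space of \<open>H\<close> (then \<open>H'\<close> can still vanish on \<open>W\<close>).
  Asking this only for \<open>W\<close> and not for the whole null space is what leaves enough room.\<close>

lemma split_off_idempotent: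
  fixes H :: "'a::field^'n^'n"
  assumes n: "n \<le> nullity H" and M: "M \<le> nullity H" "M \<le> s"
    and rank: "col_rank (mat 1 - H) \<le> n + s"
  obtains E H' where "H = E ** H'" "idempotent_nullity E n"
    "M \<le> nullity H'" "col_rank (mat 1 - H') \<le> s"
proof -
  define S where "S = col_space (mat 1 - H)"
  define r where "r = min n (vec.dim S - M)"
  have S: "vec.subspace S" by (simp add: S_def)
  \<comment> \<open>\<open>r\<close> will be the dimension of \<open>K\<close>: at most \<open>n\<close>, to fit into the kernel of \<open>E\<close>, and it
    leaves \<open>dim S - r = max (dim S - n) M\<close>, which is at most \<open>s\<close>.\<close>
  have NS: "null_space H \<subseteq> S" unfolding S_def by (rule null_space_subset_col_space_one_minus)
  then have dS: "nullity H \<le> vec.dim S" unfolding nullity_def by (rule vec.dim_subset)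
  have "col_space H \<^bold>+ S = UNIV"
  proof -
    have "x = H *v x + (mat 1 - H) *v x" for x by (simp add: matrix_action_simps)
    then show ?thesis unfolding S_def by (metis UNIV_eq_I subspace_sumI in_col_space)
  qed
  then have "CARD('n) + vec.dim (col_space H \<inter> S) = vec.dim (col_space H) + vec.dim S"
    using dim_subspace_sum[OF subspace_col_space S, of H] by (simp only: vec_dim_card)
  then have dHS: "vec.dim (col_space H \<inter> S) + nullity H = vec.dim S"
    using col_rank_plus_nullity[of H] unfolding col_rank_def by linarith
  obtain W where W: "vec.subspace W" "W \<subseteq> null_space H" "vec.dim W = M"
    using vec.choose_subspace_of_subspace[of M "null_space H"] M(1)
    by (metis nullity_def subspace_null_space vec.span_eq_iff)
  have "vec.dim (W \<inter> S) \<le> M"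
    using vec.dim_subset[of "W \<inter> S" W] W(3) by simp
  then have "vec.dim (W \<inter> S) + r \<le> vec.dim S" "vec.dim (col_space H \<inter> S) + r \<le> vec.dim S"
    using dS dHS M(1) n unfolding r_def by linarith+
  then obtain K where K: "vec.subspace K" "K \<subseteq> S" "vec.dim K = r"
      "K \<inter> W \<subseteq> {0}" "K \<inter> col_space H \<subseteq> {0}"
    by (rule avoiding_two_subspaces[OF S W(1) subspace_col_space])
  obtain F where F: "F ** F = F" "null_space F = K" "\<And>x. x \<in> W \<Longrightarrow> F *v x = x"
    using exists_idempotent[OF K(1) W(1) K(4)] by metis
  define H' where "H' = H + (mat 1 - F) ** (mat 1 - H)"
  obtain E where E: "idempotent_nullity E n" "E ** H = H" "\<And>x. x \<in> K \<Longrightarrow> E *v x = 0"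
    using exists_idempotent_nullity[OF K(1,5) _ n] K(3) unfolding r_def by (metis min.cobounded1)
  show thesis
  proof (rule that)
    show "idempotent_nullity E n" by (rule E(1))
    have "(mat 1 - F) *v y \<in> K" for y
      unfolding F(2)[symmetric] using F(1)
      by (simp add: in_null_space matrix_vector_mult_diff_rdistrib matrix_vector_mult_diff_distrib
          matrix_vector_mul_assoc)
    then have "E *v ((mat 1 - F) *v y) = 0" for y using E(3) by blast
    moreover have "E *v (H *v x) = H *v x" for x
      using E(2) by (simp add: matrix_vector_mul_assoc)
    moreover have "H' *v x = H *v x + (mat 1 - F) *v ((mat 1 - H) *v x)" for x
      by (simp add: H'_def matrix_vector_mul_assoc matrix_vector_mult_add_rdistrib)
    ultimately show "H = E ** H'"
      by (simp add: matrix_eq matrix_vector_mul_assoc[symmetric] matrix_vector_right_distrib)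
    have "W \<subseteq> null_space H'"
      using W(2) F(3) by (auto simp: H'_def in_null_space matrix_action_simps)
    then show "M \<le> nullity H'"
      unfolding nullity_def W(3)[symmetric] by (rule vec.dim_subset)
    have "(mat 1 - H') *v x = F *v ((mat 1 - H) *v x)" for x
      by (simp add: H'_def matrix_action_simps)
    then have "col_space (mat 1 - H') = (*v) F ` S"
      by (auto simp: col_space_def S_def)
    then have "col_rank (mat 1 - H') + r = vec.dim S"
      using dim_image_Int_null_space[OF S, of F] K(2,3) F(2)
      by (simp add: col_rank_def Int_absorb1)
    then show "col_rank (mat 1 - H') \<le> s"
      using rank M dS unfolding r_def S_def col_rank_def by linarith
  qed
qed

text \<open>\<open>M\<close> is the nullity that must be retained while idempotents of nullities \<open>ns\<close> are still to be
  split off: the maximum, or \<open>0\<close> when none is left.\<close>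

lemma exists_common_bound:
  fixes ns :: "nat list"
  assumes "\<forall>n\<in>set ns. n \<le> d"
  obtains M where "\<forall>n\<in>set ns. n \<le> M" "M \<le> sum_list ns" "M \<le> d"
proof (cases "ns = []")
  case True
  then show thesis using that[of 0] by simp
next
  case False
  then have "Max (set ns) \<in> set ns" by simp
  then show thesis using that[of "Max (set ns)"] assms member_le_sum_list[of "Max (set ns)" ns] by simp
qed

text \<open>Necessity holds since \<open>1 - P\<close> has rank at most the sum of the ranks of the \<open>1 - E\<^sub>i\<close>, which
  equal the nullities of the \<open>E\<^sub>i\<close>. For sufficiency, idempotents are split off from the left;
  the induction ends at \<open>H = 1\<close> because an empty sum forces \<open>1 - H\<close> to have rank \<open>0\<close>.\<close>

theorem is_product_idempotent_iff:
  fixes H :: "'a::field^'n^'n"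
  shows "is_product idempotent_nullity ns H \<longleftrightarrow>
    (\<forall>n\<in>set ns. n \<le> nullity H) \<and> col_rank (mat 1 - H) \<le> sum_list ns"
    (is "?L ns H \<longleftrightarrow> ?R ns H")
proof
  assume L: "?L ns H"
  have "col_rank (mat 1 - H) \<le> sum_list ns"
    using L
  proof (induction ns arbitrary: H)
    case Nil
    then show ?case by (simp add: is_product_Nil col_rank_def col_space_def image_def)
  next
    case (Cons n ns)
    then obtain E H' where H: "H = E ** H'" "idempotent_nullity E n" "is_product idempotent_nullity ns H'"
      by (auto simp: is_product_Cons)
    then show ?case
      using col_rank_one_minus_mult[of E H'] col_rank_one_minus_idempotent[of E] Cons.IH[OF H(3)]
      by (simp add: idempotent_nullity_def)
  qed
  moreover have "\<forall>n\<in>set ns. n \<le> nullity H"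
    using nullity_factor_le[OF L] by (auto simp: idempotent_nullity_def)
  ultimately show "?R ns H" by blast
next
  assume "?R ns H"
  then show "?L ns H"
  proof (induction ns arbitrary: H)
    case Nil
    then have "col_space (mat 1 - H) \<subseteq> {0}" by (simp add: col_rank_def)
    then have "(mat 1 - H) *v x = 0" for x using in_col_space by blast
    then have "mat 1 - H = 0" by (simp add: matrix_eq)
    then show ?case by (simp add: is_product_Nil)
  next
    case (Cons n ns)
    obtain M where M: "\<forall>n\<in>set ns. n \<le> M" "M \<le> sum_list ns" "M \<le> nullity H"
      using exists_common_bound[of ns "nullity H"] Cons.prems by auto
    obtain E H' where "H = E ** H'" "idempotent_nullity E n"
      "M \<le> nullity H'" "col_rank (mat 1 - H') \<le> sum_list ns"
      using split_off_idempotent[of n H M "sum_list ns"] M Cons.prems by auto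
    then show ?case
      using Cons.IH[of H'] M(1) by (fastforce simp: is_product_Cons)
  qed
qed


section \<open>Products of square-zero matrices\<close>

text \<open>The column space lies in the null space.\<close>

lemma CARD_le_nullity_square_zero:
  fixes Z :: "'a::field^'n^'n"
  assumes "Z ** Z = 0"
  shows "CARD('n) \<le> 2 * nullity Z"
proof -
  have "col_space Z \<subseteq> null_space Z"
    using assms by (auto simp: col_space_def in_null_space matrix_vector_mul_assoc)
  then have "col_rank Z \<le> nullity Z"
    unfolding col_rank_def nullity_def by (rule vec.dim_subset)
  then show ?thesis using col_rank_plus_nullity[of Z] by linarith
qed

text \<open>The equation \<open>G = Z ** G'\<close> prescribes \<open>Z\<close> on \<open>col_space G'\<close>, and \<open>iff\<close> says precisely that
  this prescription is compatible with \<open>N1\<close> being the null space of \<open>Z\<close>: modulo \<open>N1\<close> it is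
  well defined and injective. What remains is to extend it injectively modulo \<open>N1\<close> with values in
  \<open>N1\<close>, so that \<open>Z ** Z = 0\<close>; there is room because \<open>N1\<close> has at least half the dimension.\<close>

lemma exists_square_zero_left_factor:
  fixes G G' :: "'a::field^'n^'n"
  assumes N1: "vec.subspace N1" "col_space G \<subseteq> N1" "CARD('n) \<le> 2 * vec.dim N1"
    and iff: "\<And>x. G' *v x \<in> N1 \<longleftrightarrow> G *v x = 0"
  obtains Z where "square_zero_nullity Z (vec.dim N1)" "G = Z ** G'"
proof -
  obtain S where S: "vec.subspace S" "S \<inter> null_space G \<subseteq> {0}" "S \<^bold>+ null_space G = UNIV"
    "vec.dim S + vec.dim (null_space G) = CARD('n)"
    using complement[OF vec.subspace_UNIV subspace_null_space subset_UNIV] by (metis vec_dim_card)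
  have dS: "vec.dim S = col_rank G"
    using S(4) col_rank_plus_nullity[of G] unfolding nullity_def by linarith
  define A where "A = (*v) G' ` S"
  have A: "vec.subspace A" unfolding A_def using S(1) by auto
  have S0: "x = 0" if "x \<in> S" "G *v x = 0" for x
    using that S(2) by (auto simp: in_null_space)
  have AN1: "N1 \<inter> A \<subseteq> {0}"
  proof
    fix x assume "x \<in> N1 \<inter> A"
    then obtain s where s: "s \<in> S" "x = G' *v s" "G' *v s \<in> N1" by (auto simp: A_def)
    then have "s = 0" using S0 iff by blast
    then show "x \<in> {0}" using s(2) by simp
  qed
  have inj: "inj_on ((*v) G') S"
  proof (rule inj_onI)
    fix x y assume xy: "x \<in> S" "y \<in> S" "G' *v x = G' *v y"
    then have "G' *v (x - y) \<in> N1"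
      using vec.subspace_0[OF N1(1)] by (simp add: matrix_vector_mult_diff_distrib)
    then have "x - y = 0" using iff S0 vec.subspace_diff[OF S(1) xy(1,2)] by blast
    then show "x = y" by simp
  qed
  \<comment> \<open>On \<open>A\<close>, the matrix \<open>Z\<close> has to be \<open>G ** \<phi>\<close>; it vanishes on \<open>N1\<close>, and on the rest of
    the space it is a map \<open>H\<close> into a complement \<open>Q\<close> of \<open>col_space G\<close> in \<open>N1\<close>.\<close>
  obtain \<phi> where \<phi>: "Vector_Spaces.linear (*s) (*s) \<phi>" "\<And>x. x \<in> S \<Longrightarrow> \<phi> (G' *v x) = x"
    using vec.linear_exists_left_inverse_on[OF matrix_vector_mul_linear_gen S(1) inj] by blast
  have dA: "vec.dim A = col_rank G"
    unfolding A_def dS[symmetric] using inj S(1)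
    by (intro vec.dim_image_eq) (auto simp: vec.span_eq_iff[THEN iffD2])
  define U where "U = N1 \<^bold>+ A"
  have U: "vec.subspace U" unfolding U_def using N1(1) A by blast
  have dU: "vec.dim U = vec.dim N1 + col_rank G"
    unfolding U_def using dim_subspace_sum_direct[OF N1(1) A AN1] dA by simp
  obtain Q where Q: "vec.subspace Q" "Q \<inter> col_space G \<subseteq> {0}" "Q \<^bold>+ col_space G = N1"
    "vec.dim Q + vec.dim (col_space G) = vec.dim N1"
    using complement[OF N1(1) subspace_col_space N1(2)] by metis
  have QN1: "Q \<subseteq> N1" using Q(3) subset_subspace_sum1 by blast
  have "CARD('n) \<le> vec.dim U + vec.dim Q"
    using dU Q(4) N1(3) unfolding col_rank_def by linarith
  then obtain H :: "'a^'n^'n" where H: "null_space H = U" "col_space H \<subseteq> Q"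
    using exists_matrix_null_space[OF U Q(1)] by metis
  obtain K where K: "vec.subspace K" "N1 \<subseteq> K" "K \<inter> A \<subseteq> {0}" "K \<^bold>+ A = UNIV"
    using complement_extending[OF vec.subspace_UNIV A subset_UNIV N1(1) subset_UNIV AN1] by metis
  obtain P where P: "P ** P = P" "null_space P = K" "\<And>x. x \<in> A \<Longrightarrow> P *v x = x"
    using exists_idempotent[OF K(1) A K(3)] by metis
  \<comment> \<open>\<open>P\<close> projects onto \<open>A\<close> and kills \<open>N1\<close>. The two summands have independent ranges, so \<open>Z\<close>
    vanishes only where both do.\<close>
  define Z where "Z = G ** matrix \<phi> ** P + H"
  have Z: "Z *v x = G *v \<phi> (P *v x) + H *v x" for x
    by (simp add: Z_def matrix_action_simps matrix_works[OF \<phi>(1)])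
  have \<phi>0: "\<phi> 0 = 0"
    using \<phi>(2)[of 0] vec.subspace_0[OF S(1)] by simp
  have ZN1: "Z *v x = 0" if "x \<in> N1" for x
  proof -
    have "x \<in> U" unfolding U_def using that subset_subspace_sum1[OF A] by blast
    then have "H *v x = 0" "P *v x = 0" using that H(1) P(2) K(2) by (auto simp flip: in_null_space)
    then show ?thesis by (simp add: Z \<phi>0)
  qed
  have ZG': "Z *v (G' *v x) = G *v x" for x
  proof -
    obtain s y where sy: "s \<in> S" "y \<in> null_space G" "x = s + y"
      using S(3) by (metis UNIV_I subspace_sumE)
    have "G' *v y \<in> N1" using sy(2) iff by (simp add: in_null_space)
    have sA: "G' *v s \<in> A" using sy(1) by (simp add: A_def)
    then have "G' *v s \<in> U" unfolding U_def using subset_subspace_sum2[OF N1(1)] by blast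
    then have "H *v (G' *v s) = 0" using H(1) by (auto simp flip: in_null_space)
    then have "Z *v (G' *v s) = G *v s" using P(3)[OF sA] \<phi>(2)[OF sy(1)] by (simp add: Z)
    then show ?thesis
      using ZN1[OF \<open>G' *v y \<in> N1\<close>] sy by (simp add: matrix_vector_right_distrib in_null_space)
  qed
  have nullZ: "x \<in> N1" if "Z *v x = 0" for x
  proof -
    have "H *v x = G *v (- \<phi> (P *v x))"
      using that by (simp add: Z vec.neg add_eq_0_iff)
    then have "H *v x \<in> Q \<inter> col_space G"
      using H(2) by (metis IntI in_col_space subsetD)
    then have "x \<in> U" using Q(2) H(1) by (auto simp: in_null_space)
    then obtain u a where ua: "u \<in> N1" "a \<in> A" "x = u + a"
      unfolding U_def by (rule subspace_sumE)
    then obtain s where s: "s \<in> S" "a = G' *v s" by (auto simp: A_def)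
    have "G *v s = 0"
      using that ZN1[OF ua(1)] ZG'[of s] by (simp add: ua(3) s(2) matrix_vector_right_distrib)
    then have "s = 0" using S0 s(1) by blast
    then show "x \<in> N1" using s(2) ua by simp
  qed
  have "Z *v (Z *v x) = 0" for x
  proof (rule ZN1)
    have "G *v \<phi> (P *v x) \<in> N1" "H *v x \<in> N1"
      using N1(2) H(2) QN1 in_col_space by blast+
    then show "Z *v x \<in> N1" unfolding Z by (rule vec.subspace_add[OF N1(1)])
  qed
  then have "Z ** Z = 0" by (simp add: matrix_eq matrix_vector_mul_assoc[symmetric])
  moreover have "null_space Z = N1" using ZN1 nullZ by (auto simp: in_null_space)
  moreover have "G = Z ** G'" using ZG' by (simp add: matrix_eq matrix_vector_mul_assoc[symmetric])
  ultimately show thesis using that[of Z] by (simp add: square_zero_nullity_def nullity_def)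
qed

lemma dim_col_space_plus_null_space:
  fixes G :: "'a::field^'n^'n"
  shows "vec.dim (col_space G \<^bold>+ null_space G) + vec.dim (col_space G \<inter> null_space G) = CARD('n)"
  using dim_subspace_sum[OF subspace_col_space subspace_null_space, of G G] col_rank_plus_nullity[of G]
  by (simp add: col_rank_def nullity_def)

text \<open>The rank condition provides \<open>A \<subseteq> null_space G\<close> of dimension \<open>col_rank G\<close> with
  \<open>A \<inter> col_space G = 0\<close>. The right factor \<open>Z2\<close> maps a complement of \<open>null_space G\<close> onto
  \<open>A\<close>, and the left one maps \<open>A\<close> onto \<open>col_space G\<close>. If \<open>m2 < nullity G\<close>, then
  \<open>Z2\<close> has to be nonzero on part of \<open>null_space G\<close>, with values that \<open>Z1\<close> must annihilate.
  These values are placed in a complement \<open>C\<close> of \<open>A\<close> that contains the part of \<open>col_space G\<close>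
  inside \<open>N2\<close>: then a space \<open>N1\<close> containing them and \<open>col_space G\<close> can still avoid \<open>A\<close>, which
  is what the construction of \<open>Z1\<close> from \<open>Z2\<close> needs.\<close>

lemma exists_two_square_zero_factors:
  fixes G :: "'a::field^'n^'n"
  assumes m1: "m1 \<le> nullity G" "CARD('n) \<le> 2 * m1"
    and m2: "m2 \<le> nullity G" "CARD('n) \<le> 2 * m2"
    and rank: "2 * col_rank G \<le> vec.dim (col_space G \<^bold>+ null_space G)"
  obtains Z1 Z2 where "square_zero_nullity Z1 m1" "square_zero_nullity Z2 m2" "G = Z1 ** Z2"
proof -
  let ?R = "col_space G" and ?N = "null_space G"
  note dims = col_rank_plus_nullity[of G] dim_col_space_plus_null_space[of G]
  have r: "col_rank G \<le> m1" "col_rank G \<le> m2" using dims(1) m1 m2 by linarith+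
  have "vec.dim (?R \<inter> ?N) + col_rank G \<le> vec.dim ?N"
    using dims rank unfolding nullity_def by linarith
  then obtain A where A: "vec.subspace A" "A \<subseteq> ?N" "vec.dim A = col_rank G" "A \<inter> ?R \<subseteq> {0}"
    by (rule avoiding_subspace[OF subspace_null_space subspace_col_space])
  obtain N2 where N2: "vec.subspace N2" "A \<subseteq> N2" "N2 \<subseteq> ?N" "vec.dim N2 = m2"
    using intermediate_subspace[OF subspace_null_space A(1,2)] A(3) r(2) m2(1)
    by (metis nullity_def)
  obtain C where C: "vec.subspace C" "?R \<inter> N2 \<subseteq> C" "C \<inter> A \<subseteq> {0}" "C \<^bold>+ A = N2"
    "vec.dim C + vec.dim A = vec.dim N2"
  proof (rule complement_extending[OF N2(1) A(1) N2(2), of "?R \<inter> N2"])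
    show "vec.subspace (?R \<inter> N2)" using N2(1) by (simp add: vec.subspace_inter)
    show "?R \<inter> N2 \<inter> A \<subseteq> {0}" using A(4) by blast
  qed auto
  have CN2: "C \<subseteq> N2" using C(4) subset_subspace_sum1[OF A(1)] by blast
  obtain S where S: "vec.subspace S" "S \<inter> ?N \<subseteq> {0}" "vec.dim S + vec.dim ?N = CARD('n)"
    using complement[OF vec.subspace_UNIV subspace_null_space subset_UNIV] by (metis vec_dim_card)
  have dS: "vec.dim S = col_rank G"
    using S(3) dims(1) unfolding nullity_def by linarith
  have NS0: "N2 \<inter> S \<subseteq> {0}" using N2(3) S(2) by blast
  have dN2S: "vec.dim (N2 \<^bold>+ S) = m2 + col_rank G"
    using dim_subspace_sum_direct[OF N2(1) S(1) NS0] N2(4) dS by simp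
  have subN2S: "vec.subspace (N2 \<^bold>+ S)" using N2(1) S(1) by simp
  \<comment> \<open>\<open>F\<close> acts on \<open>null_space G\<close> modulo \<open>N2\<close>, and \<open>H\<close> acts on the complement \<open>S\<close>.\<close>
  have "CARD('n) \<le> vec.dim (N2 \<^bold>+ S) + vec.dim C"
    using dN2S C(5) A(3) N2(4) m2(2) by linarith
  then obtain F :: "'a^'n^'n" where F: "null_space F = N2 \<^bold>+ S" "col_space F \<subseteq> C"
    by (rule exists_matrix_null_space[OF subN2S C(1)])
  have "CARD('n) \<le> vec.dim ?N + vec.dim A"
    using dims(1) A(3) unfolding nullity_def by linarith
  then obtain H :: "'a^'n^'n" where H: "null_space H = ?N" "col_space H \<subseteq> A"
    by (rule exists_matrix_null_space[OF subspace_null_space A(1)])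
  define Z2 where "Z2 = F + H"
  have Z2: "Z2 *v x = F *v x + H *v x" for x by (simp add: Z2_def matrix_vector_mult_add_rdistrib)
  have FC: "F *v x \<in> C" and HA: "H *v x \<in> A" for x using F(2) H(2) in_col_space by blast+
  have null2: "null_space Z2 = N2"
  proof
    show "N2 \<subseteq> null_space Z2"
    proof
      fix x assume x: "x \<in> N2"
      then have "x \<in> null_space F" "x \<in> null_space H"
        using F(1) H(1) N2(3) subset_subspace_sum1[OF S(1)] by blast+
      then show "x \<in> null_space Z2" by (simp add: in_null_space Z2)
    qed
    show "null_space Z2 \<subseteq> N2"
    proof
      fix x assume "x \<in> null_space Z2"
      then have "F *v x = - (H *v x)" by (simp add: in_null_space Z2 eq_neg_iff_add_eq_0)
      then have "F *v x \<in> C \<inter> A" using FC HA vec.subspace_neg[OF A(1)] by (metis IntI)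
      then have "F *v x = 0" "H *v x = 0" using C(3) \<open>F *v x = - (H *v x)\<close> by auto
      then have xF: "x \<in> N2 \<^bold>+ S" and xN: "x \<in> ?N" using F(1) H(1) by (auto simp: in_null_space)
      obtain y s where ys: "y \<in> N2" "s \<in> S" "x = y + s" using xF by (rule subspace_sumE)
      have "s = x - y" using ys(3) by simp
      then have "s \<in> ?N" using xN ys(1) N2(3) vec.subspace_diff[OF subspace_null_space] by blast
      then have "s = 0" using S(2) ys(2) by blast
      then show "x \<in> N2" using ys by simp
    qed
  qed
  have "Z2 *v x \<in> N2" for x
    unfolding Z2 using FC HA CN2 N2(2) vec.subspace_add[OF N2(1)] by blast
  then have "Z2 *v (Z2 *v x) = 0" for x using null2 in_null_space by blast
  then have "Z2 ** Z2 = 0" by (simp add: matrix_eq matrix_vector_mul_assoc[symmetric])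
  then have sz2: "square_zero_nullity Z2 m2"
    using null2 N2(4) by (simp add: square_zero_nullity_def nullity_def)
  have sK: "vec.subspace (?R \<^bold>+ col_space F)" by simp
  have KA: "(?R \<^bold>+ col_space F) \<inter> A \<subseteq> {0}"
  proof
    fix x assume x: "x \<in> (?R \<^bold>+ col_space F) \<inter> A"
    then obtain g c where gc: "g \<in> ?R" "c \<in> col_space F" "x = g + c" by (auto elim: subspace_sumE)
    have cC: "c \<in> C" using gc(2) F(2) by blast
    have "g = x - c" using gc(3) by simp
    then have "g \<in> N2" using x N2(2) cC CN2 vec.subspace_diff[OF N2(1)] by blast
    then have "g \<in> C" using gc(1) C(2) by blast
    then have "x \<in> C" using gc(3) cC vec.subspace_add[OF C(1)] by blast
    then show "x \<in> {0}" using C(3) x by blast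
  qed
  have "col_rank F + vec.dim (N2 \<^bold>+ S) = CARD('n)"
    using col_rank_plus_nullity[of F] F(1) by (simp add: nullity_def)
  then have dK: "vec.dim (?R \<^bold>+ col_space F) \<le> m1"
    using dim_subspace_sum_le[OF subspace_col_space subspace_col_space, of G F] dN2S m2(2) m1(2)
    unfolding col_rank_def by linarith
  have "vec.dim (A \<inter> UNIV) + m1 \<le> vec.dim (UNIV :: ('a^'n) set)"
    unfolding vec_dim_card using A(3) dims(1) m1(1) by simp
  then obtain N1 where N1: "vec.subspace N1" "?R \<^bold>+ col_space F \<subseteq> N1" "vec.dim N1 = m1"
      "N1 \<inter> A \<subseteq> {0}"
    using extend_avoiding[OF vec.subspace_UNIV A(1) sK subset_UNIV KA dK] by metis
  have RN1: "?R \<subseteq> N1" and FN1: "F *v x \<in> N1" for x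
    using N1(2) subset_subspace_sum1 subset_subspace_sum2 in_col_space by (blast, blast)
  have iff: "Z2 *v x \<in> N1 \<longleftrightarrow> G *v x = 0" for x
  proof
    assume "Z2 *v x \<in> N1"
    then have "Z2 *v x - F *v x \<in> N1" using FN1 vec.subspace_diff[OF N1(1)] by blast
    then have "H *v x = 0" using HA N1(4) by (auto simp: Z2)
    then show "G *v x = 0" using H(1) by (auto simp flip: in_null_space)
  next
    assume "G *v x = 0"
    then have "H *v x = 0" using H(1) by (auto simp flip: in_null_space)
    then show "Z2 *v x \<in> N1" using FN1 by (simp add: Z2)
  qed
  obtain Z1 where "square_zero_nullity Z1 m1" "G = Z1 ** Z2"
    using exists_square_zero_left_factor[OF N1(1) RN1 _ iff] N1(3) m1(2) by metis
  then show thesis using that sz2 by blast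
qed

text \<open>If more factors follow, the range \<open>A\<close> of \<open>G'\<close> is only required to avoid the null space
  \<open>N1\<close> of \<open>Z\<close>. It can avoid \<open>null_space G\<close> as well, and then \<open>G'\<close> satisfies the rank
  condition for two square-zero factors, whatever \<open>G\<close> is.\<close>

lemma split_off_square_zero:
  fixes G :: "'a::field^'n^'n"
  assumes m: "m \<le> nullity G" "CARD('n) \<le> 2 * m"
  obtains Z G' where "square_zero_nullity Z m" "G = Z ** G'" "null_space G' = null_space G"
    "2 * col_rank G' \<le> vec.dim (col_space G' \<^bold>+ null_space G')"
proof -
  note dims = col_rank_plus_nullity[of G]
  have "vec.dim (col_space G) \<le> m" "m \<le> vec.dim (UNIV :: ('a^'n) set)"
    using dims m unfolding col_rank_def vec_dim_card by linarith+
  then obtain N1 where N1: "vec.subspace N1" "col_space G \<subseteq> N1" "vec.dim N1 = m"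
    using intermediate_subspace[OF vec.subspace_UNIV subspace_col_space subset_UNIV] by metis
  have "vec.dim (N1 \<inter> UNIV) + col_rank G \<le> vec.dim (UNIV :: ('a^'n) set)"
    "vec.dim (null_space G \<inter> UNIV) + col_rank G \<le> vec.dim (UNIV :: ('a^'n) set)"
    unfolding vec_dim_card using dims m(1) N1(3) by (simp_all add: nullity_def)
  then obtain A where A: "vec.subspace A" "vec.dim A = col_rank G" "A \<inter> N1 \<subseteq> {0}"
      "A \<inter> null_space G \<subseteq> {0}"
    using avoiding_two_subspaces[OF vec.subspace_UNIV N1(1) subspace_null_space] by metis
  have "CARD('n) \<le> vec.dim (null_space G) + vec.dim A"
    using A(2) dims unfolding nullity_def by linarith
  then obtain G' :: "'a^'n^'n" where G': "null_space G' = null_space G" "col_space G' \<subseteq> A"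
    by (rule exists_matrix_null_space[OF subspace_null_space A(1)])
  have "G' *v x \<in> N1 \<longleftrightarrow> G *v x = 0" for x
  proof -
    have "G' *v x \<in> A" using G'(2) in_col_space by blast
    then have "G' *v x \<in> N1 \<longleftrightarrow> G' *v x = 0" using A(3) vec.subspace_0[OF N1(1)] by auto
    then show ?thesis using G'(1) by (auto simp flip: in_null_space)
  qed
  then obtain Z where Z: "square_zero_nullity Z m" "G = Z ** G'"
    using exists_square_zero_left_factor[OF N1(1,2)] N1(3) m(2) by metis
  have "col_space G' \<inter> null_space G' \<subseteq> {0}" using G' A(4) by blast
  then have "vec.dim (col_space G' \<^bold>+ null_space G') = CARD('n)"
    using dim_subspace_sum_direct[OF subspace_col_space subspace_null_space] col_rank_plus_nullity[of G']
    by (metis col_rank_def nullity_def)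
  moreover have "2 * col_rank G' \<le> CARD('n)"
    using col_rank_plus_nullity[of G'] m unfolding nullity_def G'(1) by linarith
  ultimately show thesis using that Z G'(1) by metis
qed

text \<open>Factors are split off from the left until two remain. Only a list of exactly two needs
  the rank condition as a hypothesis, since splitting off a factor establishes it.\<close>

lemma is_product_square_zero:
  fixes G :: "'a::field^'n^'n"
  assumes "2 \<le> length ms" "\<forall>m\<in>set ms. m \<le> nullity G \<and> CARD('n) \<le> 2 * m"
    and "length ms = 2 \<Longrightarrow> 2 * col_rank G \<le> vec.dim (col_space G \<^bold>+ null_space G)"
  shows "is_product square_zero_nullity ms G"
  using assms
proof (induction ms arbitrary: G)
  case (Cons m ms)
  show ?case
  proof (cases "length ms = 1")
    case True
    then obtain m' where ms: "ms = [m']" by (auto simp: length_Suc_conv)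
    obtain Z1 Z2 where "square_zero_nullity Z1 m" "square_zero_nullity Z2 m'" "G = Z1 ** Z2"
      using exists_two_square_zero_factors[of m G m'] Cons.prems by (auto simp: ms)
    then show ?thesis
      by (auto simp: ms is_product_Cons is_product_Nil)
  next
    case False
    obtain Z G' where Z: "square_zero_nullity Z m" "G = Z ** G'" "null_space G' = null_space G"
      "2 * col_rank G' \<le> vec.dim (col_space G' \<^bold>+ null_space G')"
      using split_off_square_zero[of m G] Cons.prems(2) by auto
    have "is_product square_zero_nullity ms G'"
      using Cons.IH[of G'] Cons.prems False Z(3,4) by (auto simp: nullity_def)
    then show ?thesis using Z by (auto simp: is_product_Cons)
  qed
qed simp


section \<open>Products of idempotent and square-zero matrices\<close>

text \<open>\<open>G\<close> maps \<open>null_space (G ** G)\<close> onto \<open>col_space G \<inter> null_space G\<close>.\<close>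

lemma dim_null_space_square:
  fixes G :: "'a::field^'n^'n"
  shows "vec.dim (null_space (G ** G)) = vec.dim (col_space G \<inter> null_space G) + nullity G"
proof -
  have "(*v) G ` null_space (G ** G) = col_space G \<inter> null_space G"
    by (auto simp: in_null_space col_space_def matrix_vector_mul_assoc[symmetric])
  moreover have "null_space (G ** G) \<inter> null_space G = null_space G"
    using null_space_mult[of G G] by blast
  ultimately show ?thesis
    using dim_image_Int_null_space[OF subspace_null_space, of G "G ** G"] by (simp add: nullity_def)
qed

text \<open>\<open>Z\<close> should agree with \<open>G\<close> on as large a subspace \<open>U\<close> as possible, because the idempotent
  has to absorb the range of \<open>Z - G\<close>. Agreement forces \<open>U \<subseteq> null_space (G ** G)\<close>, and
  the best choice has \<open>dim U = m + i\<close> with \<open>i = dim (col_space G \<inter> null_space G)\<close>; what is left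
  has dimension \<open>dim (col_space G \<^bold>+ null_space G) - m \<le> p\<close>. Outside \<open>U\<close>, the values of \<open>Z\<close> are
  taken in a subspace \<open>Q\<close> of the null space \<open>N\<close> of \<open>Z\<close> that avoids \<open>col_space G\<close>; this makes the
  range of \<open>Z - G\<close> avoid \<open>col_space G\<close> too.\<close>

lemma idempotent_square_zero_factorization:
  fixes G :: "'a::field^'n^'n"
  assumes m: "m \<le> nullity G" "CARD('n) \<le> 2 * m" and p: "p \<le> nullity G"
    and dim: "vec.dim (col_space G \<^bold>+ null_space G) \<le> p + m"
  obtains E Z where "idempotent_nullity E p" "square_zero_nullity Z m" "G = E ** Z"
proof -
  let ?R = "col_space G" and ?N = "null_space G"
  define i where "i = vec.dim (?R \<inter> ?N)"
  note dims = col_rank_plus_nullity[of G] dim_col_space_plus_null_space[of G, folded i_def]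
  have sRN: "vec.subspace (?R \<inter> ?N)" by (simp add: vec.subspace_inter)
  have "i \<le> col_rank G" unfolding i_def col_rank_def by (rule vec.dim_subset) blast
  then have i: "m + i \<le> CARD('n)" "i \<le> m" using dims(1) m by linarith+
  have "vec.dim (?R \<inter> ?N) \<le> m" "m \<le> vec.dim ?N"
    using i(2) m(1) by (simp_all add: i_def nullity_def)
  then obtain N where N: "vec.subspace N" "?R \<inter> ?N \<subseteq> N" "N \<subseteq> ?N" "vec.dim N = m"
    using intermediate_subspace[OF subspace_null_space sRN] by (metis Int_lower2)
  obtain S where S: "vec.subspace S" "S \<inter> ?N \<subseteq> {0}" "S \<^bold>+ ?N = null_space (G ** G)"
    "vec.dim S + vec.dim ?N = vec.dim (null_space (G ** G))"
    using complement[OF subspace_null_space subspace_null_space null_space_mult] by metis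
  have dS: "vec.dim S = i" using S(4) dim_null_space_square[of G] by (simp add: i_def nullity_def)
  define U where "U = N \<^bold>+ S"
  have U: "vec.subspace U" unfolding U_def using N(1) S(1) by blast
  have NS: "N \<inter> S \<subseteq> {0}" using N(3) S(2) by blast
  have dU: "vec.dim U = m + i"
    unfolding U_def using dim_subspace_sum_direct[OF N(1) S(1) NS] dS N(4) by simp
  have NU: "N \<subseteq> U" unfolding U_def by (rule subset_subspace_sum1[OF S(1)])
  have UN: "x \<in> N" if "x \<in> U" "G *v x = 0" for x
  proof -
    obtain y s where ys: "y \<in> N" "s \<in> S" "x = y + s"
      using \<open>x \<in> U\<close> unfolding U_def by (rule subspace_sumE)
    have "y \<in> ?N" using ys(1) N(3) by blast
    then have "s \<in> ?N"
      using that(2) ys(3) by (simp add: in_null_space matrix_vector_right_distrib)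
    then have "s = 0" using S(2) ys(2) by blast
    then show ?thesis using ys by simp
  qed
  have GU: "G *v x \<in> ?R \<inter> ?N" if "x \<in> U" for x
  proof -
    have "S \<subseteq> null_space (G ** G)" using S(3) subset_subspace_sum1[of ?N S] by simp
    then have "U \<subseteq> null_space (G ** G)"
      unfolding U_def using N(3) null_space_mult[of G G] by (intro subspace_sum_least) auto
    then show ?thesis using that by (auto simp: in_null_space matrix_vector_mul_assoc)
  qed
  have "vec.dim (?R \<inter> ?N \<inter> N) + (CARD('n) - (m + i)) \<le> vec.dim N"
  proof -
    have "vec.dim (?R \<inter> ?N \<inter> N) \<le> i" unfolding i_def by (rule vec.dim_subset) blast
    then show ?thesis using N(4) m(2) i by linarith
  qed
  then obtain Q where Q: "vec.subspace Q" "Q \<subseteq> N" "vec.dim Q = CARD('n) - (m + i)"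
    "Q \<inter> (?R \<inter> ?N) \<subseteq> {0}"
    by (rule avoiding_subspace[OF N(1) sRN])
  have "CARD('n) \<le> vec.dim U + vec.dim Q" using dU Q(3) by linarith
  then obtain H :: "'a^'n^'n" where H: "null_space H = U" "col_space H \<subseteq> Q"
    by (rule exists_matrix_null_space[OF U Q(1)])
  have HQ: "H *v x \<in> Q" for x using H(2) in_col_space by blast
  obtain T where T: "vec.subspace T" "T \<inter> U \<subseteq> {0}" "T \<^bold>+ U = UNIV"
    using complement[OF vec.subspace_UNIV U subset_UNIV] by metis
  obtain P where P: "P ** P = P" "null_space P = T" "\<And>x. x \<in> U \<Longrightarrow> P *v x = x"
    using exists_idempotent[OF T(1) U T(2)] by metis
  have PU: "P *v x \<in> U" for x
  proof -
    obtain t u where "t \<in> T" "u \<in> U" "x = t + u" using T(3) by (metis UNIV_I subspace_sumE)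
    then show ?thesis
      using P(3) by (simp add: matrix_vector_right_distrib flip: P(2)) (simp add: in_null_space)
  qed
  \<comment> \<open>\<open>P\<close> projects onto \<open>U\<close> and \<open>H\<close> vanishes exactly there, so \<open>Z\<close> is \<open>G\<close> on \<open>U\<close> and \<open>H\<close> on \<open>T\<close>.\<close>
  define Z where "Z = G ** P + H"
  have Z: "Z *v x = G *v (P *v x) + H *v x" for x by (simp add: Z_def matrix_action_simps)
  have HU: "H *v x = 0 \<longleftrightarrow> x \<in> U" for x using H(1) by (auto simp flip: in_null_space)
  have nullZ: "null_space Z = N"
  proof
    show "N \<subseteq> null_space Z"
    proof
      fix x assume x: "x \<in> N"
      then have "x \<in> U" "G *v x = 0" using NU N(3) by (auto simp flip: in_null_space)
      then show "x \<in> null_space Z" using HU P(3) by (simp add: in_null_space Z)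
    qed
    show "null_space Z \<subseteq> N"
    proof
      fix x assume "x \<in> null_space Z"
      then have eq: "H *v x = - (G *v (P *v x))" by (simp add: in_null_space Z add_eq_0_iff)
      then have "H *v x \<in> ?R \<inter> ?N" using GU[OF PU] vec.subspace_neg[OF sRN] by metis
      then have "H *v x = 0" using HQ Q(4) by blast
      then have "x \<in> U" by (simp add: HU)
      then show "x \<in> N" using UN eq P(3) \<open>H *v x = 0\<close> by simp
    qed
  qed
  have "Z *v x \<in> N" for x
    unfolding Z using GU[OF PU] HQ N(2) Q(2) by (intro vec.subspace_add[OF N(1)]) blast+
  then have "Z *v (Z *v x) = 0" for x using nullZ in_null_space by blast
  then have "Z ** Z = 0" by (simp add: matrix_eq matrix_vector_mul_assoc[symmetric])
  then have sz: "square_zero_nullity Z m"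
    using nullZ N(4) by (simp add: square_zero_nullity_def nullity_def)
  let ?X = "Z - G"
  have XU: "?X *v x = 0" if "x \<in> U" for x
    using that HU P(3) by (simp add: Z matrix_vector_mult_diff_rdistrib)
  then have "vec.dim U \<le> nullity ?X"
    unfolding nullity_def by (intro vec.dim_subset) (auto simp: in_null_space)
  then have dX: "vec.dim (col_space ?X) \<le> p"
    using col_rank_plus_nullity[of ?X] dU dims(2) dim unfolding col_rank_def by linarith
  have XR: "col_space ?X \<inter> ?R \<subseteq> {0}"
  proof
    fix y assume "y \<in> col_space ?X \<inter> ?R"
    then obtain x z where x: "y = ?X *v x" and z: "y = G *v z" unfolding col_space_def by blast
    have "H *v x = G *v (z + x - P *v x)"
      using x z by (simp add: Z matrix_action_simps algebra_simps)
    then have "H *v x \<in> ?R" by simp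
    then have "H *v x = 0" using HQ Q(2,4) N(3) by blast
    then have "x \<in> U" by (simp add: HU)
    then show "y \<in> {0}" using XU x by simp
  qed
  obtain E where E: "idempotent_nullity E p" "E ** G = G" "\<And>x. x \<in> col_space ?X \<Longrightarrow> E *v x = 0"
    using exists_idempotent_nullity[OF subspace_col_space XR dX p] by metis
  have "G *v x = E *v (Z *v x)" for x
  proof -
    have "E *v (Z *v x) = E *v (G *v x) + E *v (?X *v x)"
      by (simp add: matrix_vector_right_distrib[symmetric] matrix_vector_mult_diff_rdistrib)
    moreover have "E *v (?X *v x) = 0" by (rule E(3)) simp
    ultimately show ?thesis using E(2) by (simp add: matrix_vector_mul_assoc)
  qed
  then have "G = E ** Z" by (simp add: matrix_eq matrix_vector_mul_assoc[symmetric])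
  then show thesis using that E(1) sz by blast
qed

text \<open>Let \<open>q\<close> be the amount by which \<open>G\<close> fails the rank condition for two square-zero factors, or \<open>0\<close> if it
  does not. Take \<open>q\<close> vectors of \<open>null_space (G ** G)\<close>, spanning \<open>L\<close>, that are independent modulo
  \<open>null_space G\<close>. Their images lie in \<open>col_space G \<inter> null_space G\<close>; add to these images independent vectors of a space \<open>K\<close> that avoids
  \<open>col_space G \<^bold>+ null_space G\<close>. The null space stays the same, and its
  intersection with the range loses \<open>q\<close> dimensions. The change is absorbed by an idempotent of
  nullity \<open>p \<ge> q\<close>.\<close>

lemma split_off_idempotent_raising_dim:
  fixes G :: "'a::field^'n^'n"
  assumes p: "p \<le> nullity G" and half: "CARD('n) \<le> 2 * nullity G"
    and rank: "2 * col_rank G \<le> vec.dim (col_space G \<^bold>+ null_space G) + p"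
  obtains E G' where "idempotent_nullity E p" "G = E ** G'" "null_space G' = null_space G"
    "2 * col_rank G' \<le> vec.dim (col_space G' \<^bold>+ null_space G')"
proof -
  let ?R = "col_space G" and ?N = "null_space G"
  define i where "i = vec.dim (?R \<inter> ?N)"
  define q where "q = 2 * col_rank G - vec.dim (?R \<^bold>+ ?N)"
  note dims = col_rank_plus_nullity[of G] dim_col_space_plus_null_space[of G, folded i_def]
  have q: "q \<le> p" "q \<le> i" using dims half rank unfolding q_def by linarith+
  have sRN: "vec.subspace (?R \<^bold>+ ?N)" by simp
  have "vec.dim ((?R \<^bold>+ ?N) \<inter> UNIV) + q \<le> vec.dim (UNIV :: ('a^'n) set)"
    unfolding vec_dim_card Int_UNIV_right using dims(2) q(2) by linarith
  then obtain K where K: "vec.subspace K" "vec.dim K = q" "K \<inter> (?R \<^bold>+ ?N) \<subseteq> {0}"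
    by (rule avoiding_subspace[OF vec.subspace_UNIV sRN])
  have "vec.dim (?N \<inter> null_space (G ** G)) + q \<le> vec.dim (null_space (G ** G))"
    using dim_null_space_square[of G] null_space_mult[of G G] q(2)
    by (simp add: Int_absorb2 i_def nullity_def)
  then obtain L where L: "vec.subspace L" "L \<subseteq> null_space (G ** G)" "vec.dim L = q" "L \<inter> ?N \<subseteq> {0}"
    by (rule avoiding_subspace[OF subspace_null_space subspace_null_space])
  obtain M where M: "vec.subspace M" "?N \<subseteq> M" "M \<inter> L \<subseteq> {0}" "vec.dim M + vec.dim L = CARD('n)"
    using complement_extending[OF vec.subspace_UNIV L(1) subset_UNIV subspace_null_space subset_UNIV]
      L(4) by (metis Int_commute vec_dim_card)
  have "CARD('n) \<le> vec.dim M + vec.dim K" using M(4) L(3) K(2) by linarith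
  then obtain X :: "'a^'n^'n" where X: "null_space X = M" "col_space X \<subseteq> K"
    by (rule exists_matrix_null_space[OF M(1) K(1)])
  have XK: "X *v x \<in> K" for x using X(2) in_col_space by blast
  \<comment> \<open>\<open>X\<close> vanishes on \<open>null_space G\<close> and is injective on \<open>L\<close>.\<close>
  define G' where "G' = G + X"
  have G': "G' *v x = G *v x + X *v x" for x by (simp add: G'_def matrix_vector_mult_add_rdistrib)
  have G'N: "x \<in> M \<and> G *v x = G' *v x" if "G' *v x \<in> ?N" for x
  proof -
    have "X *v x = G *v (- x) + G' *v x" by (simp add: G' vec.neg)
    then have "X *v x \<in> ?R \<^bold>+ ?N" using that by (metis in_col_space subspace_sumI)
    then have "X *v x = 0" using XK K(3) by blast
    then show ?thesis using X(1) by (auto simp: G' in_null_space)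
  qed
  have null: "null_space G' = ?N"
  proof
    show "null_space G' \<subseteq> ?N"
    proof
      fix x assume x: "x \<in> null_space G'"
      then have "G' *v x \<in> ?N" using vec.subspace_0[OF subspace_null_space] by (metis in_null_space)
      then show "x \<in> ?N" using G'N x by (metis in_null_space)
    qed
    show "?N \<subseteq> null_space G'"
    proof
      fix x assume x: "x \<in> ?N"
      then have "X *v x = 0" using M(2) X(1) by (auto simp flip: in_null_space)
      then show "x \<in> null_space G'" using x by (simp add: G' in_null_space)
    qed
  qed
  \<comment> \<open>\<open>G'\<close> maps a vector into \<open>null_space G\<close> only if \<open>G\<close> does and the vector lies in \<open>M\<close>, so
    the intersection of range and null space comes from \<open>M \<inter> null_space (G ** G)\<close>, which has lost
    the \<open>q\<close> dimensions of \<open>L\<close>.\<close>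
  have sMP: "vec.subspace (M \<inter> null_space (G ** G))" using M(1) by (simp add: vec.subspace_inter)
  have "vec.dim (M \<inter> null_space (G ** G)) + q \<le> vec.dim (null_space (G ** G))"
  proof -
    have "M \<inter> null_space (G ** G) \<inter> L \<subseteq> {0}" using M(3) by blast
    then have "vec.dim (M \<inter> null_space (G ** G)) + q = vec.dim (M \<inter> null_space (G ** G) \<^bold>+ L)"
      using dim_subspace_sum_direct[OF sMP L(1)] L(3) by simp
    also have "\<dots> \<le> vec.dim (null_space (G ** G))"
      by (intro vec.dim_subset subspace_sum_least L(2)) auto
    finally show ?thesis .
  qed
  moreover have "M \<inter> null_space (G ** G) \<inter> ?N = ?N"
    using M(2) null_space_mult[of G G] by blast
  ultimately have img: "vec.dim ((*v) G ` (M \<inter> null_space (G ** G))) + q \<le> i"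
    using dim_image_Int_null_space[OF sMP, of G] dim_null_space_square[of G]
    by (simp add: i_def nullity_def)
  have "col_space G' \<inter> ?N \<subseteq> (*v) G ` (M \<inter> null_space (G ** G))"
  proof
    fix y assume y: "y \<in> col_space G' \<inter> ?N"
    then obtain x where x: "y = G' *v x" by (auto simp: col_space_def)
    then have "x \<in> M" "G *v x = y" using G'N y by auto
    moreover have "x \<in> null_space (G ** G)"
      using y \<open>G *v x = y\<close> by (simp add: in_null_space matrix_vector_mul_assoc[symmetric])
    ultimately show "y \<in> (*v) G ` (M \<inter> null_space (G ** G))" by blast
  qed
  then have "vec.dim (col_space G' \<inter> ?N) + q \<le> i"
    using img vec.dim_subset by (meson add_le_mono1 le_trans)
  then have rank': "2 * col_rank G' \<le> vec.dim (col_space G' \<^bold>+ null_space G')"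
    using dim_col_space_plus_null_space[of G'] col_rank_plus_nullity[of G'] dims
    unfolding null q_def nullity_def by linarith
  have KR: "K \<inter> ?R \<subseteq> {0}" using K(3) subset_subspace_sum1[of ?N ?R] by auto
  obtain E where E: "idempotent_nullity E p" "E ** G = G" "\<And>x. x \<in> K \<Longrightarrow> E *v x = 0"
    using exists_idempotent_nullity[OF K(1) KR _ p] K(2) q(1) by metis
  have "E *v (G *v x) = G *v x" for x using E(2) by (simp add: matrix_vector_mul_assoc)
  then have "G = E ** G'"
    using E(3)[OF XK] by (simp add: matrix_eq matrix_action_simps G')
  then show thesis using that E(1) null rank' by metis
qed

text \<open>Let \<open>D = col_space (1 - P)\<close>. Since \<open>P Z = Z - (1 - P) Z\<close> and \<open>col_space Z \<subseteq> null_space Z\<close>, the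
  range of \<open>P Z\<close> lies in \<open>D \<^bold>+ null_space Z\<close>. The null space of \<open>P Z\<close> may exceed that of \<open>Z\<close>, but
  \<open>Z\<close> maps the excess injectively into \<open>D \<inter> null_space Z\<close>, whose dimension is exactly what is saved
  in \<open>D \<^bold>+ null_space Z\<close>.\<close>

lemma dim_le_of_product_one_square_zero:
  fixes P Z :: "'a::field^'n^'n"
  assumes Z: "Z ** Z = 0"
  shows "vec.dim (col_space (P ** Z) \<^bold>+ null_space (P ** Z)) \<le> col_rank (mat 1 - P) + nullity Z"
proof -
  let ?G = "P ** Z" and ?D = "col_space (mat 1 - P)"
  have RZ: "col_space Z \<subseteq> null_space Z"
    using Z by (auto simp: col_space_def in_null_space matrix_vector_mul_assoc)
  have sub: "vec.subspace (?D \<^bold>+ null_space Z)" by simp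
  have "col_space ?G \<subseteq> ?D \<^bold>+ null_space Z"
  proof
    fix y assume "y \<in> col_space ?G"
    then obtain x where "y = ?G *v x" by (auto simp: col_space_def)
    then have "y = (mat 1 - P) *v (- (Z *v x)) + Z *v x" by (simp add: matrix_action_simps vec.neg)
    moreover have "Z *v x \<in> null_space Z" using RZ by blast
    ultimately show "y \<in> ?D \<^bold>+ null_space Z" by (metis subspace_sumI in_col_space)
  qed
  then have "col_space ?G \<^bold>+ null_space ?G \<subseteq> (?D \<^bold>+ null_space Z) \<^bold>+ null_space ?G"
    unfolding subspace_sum_def[of "col_space ?G"] subspace_sum_def[of "?D \<^bold>+ null_space Z"] by blast
  then have "vec.dim (col_space ?G \<^bold>+ null_space ?G) \<le> vec.dim ((?D \<^bold>+ null_space Z) \<^bold>+ null_space ?G)"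
    by (rule vec.dim_subset)
  moreover have "vec.dim ((?D \<^bold>+ null_space Z) \<^bold>+ null_space ?G) + nullity Z
      \<le> vec.dim (?D \<^bold>+ null_space Z) + nullity ?G"
  proof -
    have "null_space Z \<subseteq> (?D \<^bold>+ null_space Z) \<inter> null_space ?G"
      using subset_subspace_sum2[of ?D "null_space Z"] null_space_mult[of Z P] by simp
    then have "nullity Z \<le> vec.dim ((?D \<^bold>+ null_space Z) \<inter> null_space ?G)"
      unfolding nullity_def by (rule vec.dim_subset)
    then show ?thesis
      using dim_subspace_sum[OF sub subspace_null_space, of ?G] unfolding nullity_def by linarith
  qed
  moreover have "nullity ?G \<le> nullity Z + vec.dim (?D \<inter> null_space Z)"
  proof -
    have "(*v) Z ` null_space ?G \<subseteq> ?D \<inter> null_space Z"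
      using RZ null_space_subset_col_space_one_minus[of P]
      by (auto simp: in_null_space matrix_vector_mul_assoc[symmetric])
    then have "vec.dim ((*v) Z ` null_space ?G) \<le> vec.dim (?D \<inter> null_space Z)"
      by (rule vec.dim_subset)
    moreover have "null_space ?G \<inter> null_space Z = null_space Z"
      using null_space_mult[of Z P] by blast
    ultimately show ?thesis
      using dim_image_Int_null_space[OF subspace_null_space, of Z ?G] unfolding nullity_def by simp
  qed
  ultimately show ?thesis
    using dim_subspace_sum[OF subspace_col_space subspace_null_space, of "mat 1 - P" Z]
    unfolding col_rank_def nullity_def by linarith
qed

text \<open>Let \<open>A = col_space Z2 \<subseteq> null_space G\<close>. As \<open>G = P Z1 Z2\<close>, the null space of \<open>Z1\<close> leaves out at
  least \<open>col_rank G\<close> dimensions of \<open>A\<close>. It contains \<open>col_space (Z1 ** Z2)\<close>, which differs from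
  \<open>col_space G\<close> by at most \<open>col_rank (1 - P)\<close> dimensions. So \<open>A\<close> contributes at least
  \<open>col_rank G - col_rank (1 - P)\<close> dimensions to \<open>col_space G \<^bold>+ null_space G\<close> beyond \<open>col_space G\<close>.\<close>

lemma rank_le_of_product_two_square_zero:
  fixes P Z1 Z2 :: "'a::field^'n^'n"
  assumes Z1: "Z1 ** Z1 = 0" and Z2: "Z2 ** Z2 = 0" and G: "G = P ** (Z1 ** Z2)"
  shows "2 * col_rank G \<le> col_rank (mat 1 - P) + vec.dim (col_space G \<^bold>+ null_space G)"
proof -
  let ?R = "col_space G" and ?A = "col_space Z2" and ?Z = "Z1 ** Z2"
  have sRR: "vec.subspace (?R \<inter> col_space ?Z)" by (simp add: vec.subspace_inter)
  have sAR: "vec.subspace (?A \<inter> ?R)" by (simp add: vec.subspace_inter)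
  have "?R \<^bold>+ col_space ?Z \<subseteq> col_space (mat 1 - P) \<^bold>+ col_space ?Z"
  proof (rule subspace_sum_least)
    show "?R \<subseteq> col_space (mat 1 - P) \<^bold>+ col_space ?Z"
    proof
      fix y assume "y \<in> ?R"
      then obtain x where "y = G *v x" by (auto simp: col_space_def)
      then have "y = (mat 1 - P) *v (- (?Z *v x)) + ?Z *v x"
        by (simp add: G matrix_action_simps vec.neg)
      then show "y \<in> col_space (mat 1 - P) \<^bold>+ col_space ?Z" by (metis subspace_sumI in_col_space)
    qed
  qed (auto intro: subset_subspace_sum2[THEN subsetD])
  then have "vec.dim (?R \<^bold>+ col_space ?Z) \<le> vec.dim (col_space (mat 1 - P) \<^bold>+ col_space ?Z)"
    by (rule vec.dim_subset)
  also have "\<dots> \<le> col_rank (mat 1 - P) + vec.dim (col_space ?Z)"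
    unfolding col_rank_def by (rule dim_subspace_sum_le) auto
  finally have 1: "col_rank G \<le> col_rank (mat 1 - P) + vec.dim (?R \<inter> col_space ?Z)"
    using dim_subspace_sum[OF subspace_col_space subspace_col_space, of G ?Z]
    unfolding col_rank_def by linarith
  have "vec.dim ((?A \<inter> ?R) \<^bold>+ (?R \<inter> col_space ?Z)) \<le> vec.dim ?R"
    by (intro vec.dim_subset subspace_sum_least) auto
  then have 2: "vec.dim (?A \<inter> ?R) + vec.dim (?R \<inter> col_space ?Z)
      \<le> vec.dim ((?A \<inter> ?R) \<inter> (?R \<inter> col_space ?Z)) + col_rank G"
    using dim_subspace_sum[OF sAR sRR] unfolding col_rank_def by linarith
  have "col_space ?Z \<subseteq> null_space Z1"
    using Z1 by (auto simp: col_space_def in_null_space matrix_vector_mul_assoc[symmetric])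
      (metis matrix_vector_mul_assoc matrix_vector_mult_0)
  then have 3: "vec.dim ((?A \<inter> ?R) \<inter> (?R \<inter> col_space ?Z)) \<le> vec.dim (?A \<inter> null_space Z1)"
    by (intro vec.dim_subset) blast
  have "?R = (*v) P ` ((*v) Z1 ` ?A)"
    by (auto simp: col_space_def G matrix_vector_mul_assoc[symmetric])
  then have "col_rank G \<le> vec.dim ((*v) Z1 ` ?A)"
    unfolding col_rank_def by (metis matrix_vector_mul_linear_gen vec.dim_image_le)
  then have 4: "col_rank G + vec.dim (?A \<inter> null_space Z1) \<le> vec.dim ?A"
    using dim_image_Int_null_space[OF subspace_col_space, of Z1 Z2] by linarith
  have "?A \<subseteq> null_space G"
    using Z2 by (auto simp: col_space_def in_null_space G matrix_vector_mul_assoc[symmetric])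
      (metis matrix_vector_mul_assoc matrix_vector_mult_0 matrix_vector_mult_0_right)
  then have "vec.dim (?A \<^bold>+ ?R) \<le> vec.dim (?R \<^bold>+ null_space G)"
    by (intro vec.dim_subset subspace_sum_least)
      (auto intro: subset_subspace_sum1[THEN subsetD] subset_subspace_sum2[THEN subsetD])
  then have 5: "vec.dim ?A + col_rank G \<le> vec.dim (?A \<inter> ?R) + vec.dim (?R \<^bold>+ null_space G)"
    using dim_subspace_sum[OF subspace_col_space subspace_col_space, of Z2 G]
    unfolding col_rank_def by linarith
  from 1 2 3 4 5 show ?thesis by linarith
qed

text \<open>This turns the rank condition for two square-zero factors into one on \<open>nullity0\<close>.\<close>

lemma col_rank_plus_nullity0:
  "col_rank G + nullity0 G = vec.dim (col_space G \<^bold>+ null_space G)"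
proof -
  have "vec.dim (col_space G \<inter> null_space G) \<le> nullity G"
    unfolding nullity_def by (rule vec.dim_subset) blast
  then show ?thesis
    using dim_col_space_plus_null_space[of G] col_rank_plus_nullity[of G]
    unfolding nullity0_def by linarith
qed

text \<open>With a square-zero factor present, sufficiency takes for the product of the idempotents a single
  idempotent \<open>E\<close>, of nullity \<open>p\<close> at least the maximum \<open>M\<close> of \<open>ns\<close> and at most its sum. With one
  or two of them \<open>p\<close> is the larger of \<open>M\<close> and the deficit in the respective dimension condition, and
  with three or more \<open>p = M\<close>.\<close>

theorem product_idempotent_square_zero_iff:
  fixes H :: "'a::field^'n^'n"
  shows "(\<exists>P Q. H = P ** Q \<and> is_product idempotent_nullity ns P \<and> is_product square_zero_nullity ms Q)
    \<longleftrightarrow> (\<forall>n\<in>set ns. n \<le> nullity H) \<and> (\<forall>m\<in>set ms. m \<le> nullity H \<and> CARD('n) \<le> 2 * m)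
      \<and> (length ms = 0 \<longrightarrow> col_rank (mat 1 - H) \<le> sum_list ns)
      \<and> (length ms = 1 \<longrightarrow> vec.dim (col_space H \<^bold>+ null_space H) \<le> sum_list ns + ms ! 0)
      \<and> (length ms = 2 \<longrightarrow> col_rank H \<le> sum_list ns + nullity0 H)"
    (is "?L \<longleftrightarrow> ?R")
proof
  assume ?L
  then obtain P Q where H: "H = P ** Q" and P: "is_product idempotent_nullity ns P"
    and Q: "is_product square_zero_nullity ms Q" by blast
  have rP: "col_rank (mat 1 - P) \<le> sum_list ns"
    using P unfolding is_product_idempotent_iff by blast
  have "\<forall>n\<in>set ns. n \<le> nullity H"
    using P nullity_mult_left[of P Q] unfolding is_product_idempotent_iff H by fastforce
  moreover have "m \<le> nullity H \<and> CARD('n) \<le> 2 * m" if m: "m \<in> set ms" for m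
  proof
    have "m \<le> nullity Q"
      using nullity_factor_le[OF Q m] by (simp add: square_zero_nullity_def)
    then show "m \<le> nullity H" using nullity_mult_right[of Q P] by (simp add: H)
    obtain Zs :: "('a^'n^'n) list" where "list_all2 square_zero_nullity Zs ms"
      using Q by (auto simp: is_product_def)
    then obtain Z :: "'a^'n^'n" where "square_zero_nullity Z m"
      using m by (metis in_set_conv_nth list_all2_conv_all_nth)
    then show "CARD('n) \<le> 2 * m"
      using CARD_le_nullity_square_zero[of Z] by (auto simp: square_zero_nullity_def)
  qed
  moreover have "col_rank (mat 1 - H) \<le> sum_list ns" if "length ms = 0"
    using that Q rP by (simp add: H is_product_Nil)
  moreover have "vec.dim (col_space H \<^bold>+ null_space H) \<le> sum_list ns + ms ! 0" if len: "length ms = 1"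
  proof -
    obtain m where ms: "ms = [m]" using len by (auto simp: length_Suc_conv)
    then have "Q ** Q = 0" "nullity Q = m"
      using Q by (auto simp: is_product_Cons is_product_Nil square_zero_nullity_def)
    then show ?thesis
      using dim_le_of_product_one_square_zero[of Q P] rP by (simp add: H ms)
  qed
  moreover have "col_rank H \<le> sum_list ns + nullity0 H" if len: "length ms = 2"
  proof -
    obtain m1 m2 where ms: "ms = [m1, m2]" using len by (auto simp: length_Suc_conv numeral_2_eq_2)
    then obtain Z1 Z2 where "Q = Z1 ** Z2" "Z1 ** Z1 = 0" "Z2 ** Z2 = 0"
      using Q by (auto simp: is_product_Cons is_product_Nil square_zero_nullity_def)
    then have "2 * col_rank H \<le> col_rank (mat 1 - P) + vec.dim (col_space H \<^bold>+ null_space H)"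
      using rank_le_of_product_two_square_zero[of Z1 Z2 H P] H by simp
    then show ?thesis using rP col_rank_plus_nullity0[of H] by linarith
  qed
  ultimately show ?R by blast
next
  assume R: ?R
  obtain M where M: "\<forall>n\<in>set ns. n \<le> M" "M \<le> sum_list ns" "M \<le> nullity H"
    using exists_common_bound[of ns "nullity H"] R by auto
  \<comment> \<open>For an idempotent \<open>E\<close> the rank of \<open>1 - E\<close> is its nullity, so the criterion for products of
    idempotents reads \<open>n \<le> p\<close> for all entries \<open>n\<close>, and \<open>p \<le> sum_list ns\<close>.\<close>
  have idem: "is_product idempotent_nullity ns E"
    if "idempotent_nullity E p" "M \<le> p" "p \<le> sum_list ns" for E :: "'a^'n^'n" and p
    unfolding is_product_idempotent_iff
    using that M(1) col_rank_one_minus_idempotent[of E] by (fastforce simp: idempotent_nullity_def)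
  consider "ms = []" | m where "ms = [m]" | m1 m2 where "ms = [m1, m2]" | "3 \<le> length ms"
    by (cases ms rule: list.exhaust; cases "tl ms" rule: list.exhaust; cases "tl (tl ms)") auto
  then show ?L
  proof cases
    case 1
    then have "is_product idempotent_nullity ns H" "is_product square_zero_nullity ms (mat 1 :: 'a^'n^'n)"
      using R by (simp_all add: is_product_idempotent_iff is_product_Nil)
    then show ?L by (metis matrix_mul_rid)
  next
    case (2 m)
    let ?p = "max M (vec.dim (col_space H \<^bold>+ null_space H) - m)"
    have m: "m \<le> nullity H" "CARD('n) \<le> 2 * m" using R 2 by auto
    have "?p \<le> nullity H" "vec.dim (col_space H \<^bold>+ null_space H) \<le> ?p + m"
      using M(3) m dim_le_CARD[of "col_space H \<^bold>+ null_space H"] by auto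
    then obtain E Z where EZ: "idempotent_nullity E ?p" "square_zero_nullity Z m" "H = E ** Z"
      using idempotent_square_zero_factorization[OF m] by metis
    have "is_product idempotent_nullity ns E"
      using idem[OF EZ(1)] M(2) R 2 by auto
    moreover have "is_product square_zero_nullity ms Z"
      using EZ(2) by (auto simp: 2 is_product_Cons is_product_Nil)
    ultimately show ?L using EZ(3) by blast
  next
    case (3 m1 m2)
    let ?p = "max M (col_rank H - nullity0 H)"
    have half: "CARD('n) \<le> 2 * nullity H" using R 3 by auto
    have p: "?p \<le> nullity H" "?p \<le> sum_list ns"
      using M(2,3) R 3 half col_rank_plus_nullity[of H] by auto
    have "2 * col_rank H \<le> vec.dim (col_space H \<^bold>+ null_space H) + ?p"
      using col_rank_plus_nullity0[of H] by linarith
    then obtain E G where EG: "idempotent_nullity E ?p" "H = E ** G" "null_space G = null_space H"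
      "2 * col_rank G \<le> vec.dim (col_space G \<^bold>+ null_space G)"
      using split_off_idempotent_raising_dim[OF p(1) half] by metis
    have "is_product square_zero_nullity ms G"
      using R 3 EG(3,4) by (intro is_product_square_zero) (auto simp: nullity_def)
    then show ?L using EG(2) idem[OF EG(1) _ p(2)] by auto
  next
    case 4
    \<comment> \<open>\<open>E\<close> fixes the range of \<open>H\<close> pointwise, so \<open>H\<close> itself can be the product of the \<open>Z\<^sub>j\<close>.\<close>
    obtain E where E: "idempotent_nullity E M" "E ** H = H"
      using exists_idempotent_nullity[OF vec.subspace_single_0, of H M] M(3) by auto
    have "is_product square_zero_nullity ms H"
      using R 4 by (intro is_product_square_zero) auto
    then show ?L using E(2) idem[OF E(1) _ M(2)] by (metis order_refl)
  qed
qed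

section \<open>Indexed and scaled products\<close>

lemma mat_scale_mult_vector: "mat_scale c A *v x = c *s (A *v x)"
  for A :: "'a::field^'n^'m"
  by (simp add: mat_scale_def matrix_vector_mult_def vec_eq_iff sum_distrib_left mult.assoc)

lemma mat_scale_mult: "mat_scale c A ** B = mat_scale c (A ** B)"
  for A B :: "'a::field^'n^'n"
  by (simp add: matrix_eq matrix_vector_mul_assoc[symmetric] mat_scale_mult_vector)

lemma mat_scale_mat_scale: "mat_scale c (mat_scale d A) = mat_scale (c * d) A"
  for A :: "'a::field^'n^'n"
  by (simp add: matrix_eq mat_scale_mult_vector vec.scale_scale)

lemma null_space_mat_scale: "c \<noteq> 0 \<Longrightarrow> null_space (mat_scale c A) = null_space A"
  by (simp add: null_space_def mat_scale_mult_vector)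

lemma col_space_mat_scale:
  assumes "c \<noteq> 0"
  shows "col_space (mat_scale c A) = col_space A"
proof -
  have "mat_scale c A *v x = A *v (c *s x)" for x
    by (simp add: mat_scale_mult_vector vector_scalar_commute)
  moreover have "A *v x = mat_scale c A *v (inverse c *s x)" for x
    using assms by (simp add: mat_scale_mult_vector vector_scalar_commute[symmetric])
  ultimately show ?thesis unfolding col_space_def by (metis (no_types) subset_antisym image_subsetI rangeI)
qed

lemma mat_prod_list_scale:
  fixes E :: "nat \<Rightarrow> 'a::field^'n^'n"
  shows "mat_prod_list (map (\<lambda>i. mat_scale (cs i) (E i)) is)
    = mat_scale (prod_list (map cs is)) (mat_prod_list (map E is))"
proof (induction "is")
  case Nil
  show ?case by (simp add: mat_prod_list_def matrix_eq mat_scale_mult_vector)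
next
  case (Cons i "is")
  have "mat_scale a A ** mat_scale b B = mat_scale (a * b) (A ** B)" for a b and A B :: "'a^'n^'n"
    by (simp add: matrix_eq matrix_vector_mul_assoc[symmetric] mat_scale_mult_vector
        vector_scalar_commute[symmetric])
  then show ?case using Cons by (simp add: mat_prod_list_def)
qed

lemma is_product_indexed:
  "is_product Q (map ns [1..<Suc k]) A \<longleftrightarrow>
    (\<exists>E. A = mat_prod_list (map E [1..<Suc k]) \<and> (\<forall>i\<in>{1..k}. Q (E i) (ns i)))"
proof
  assume "is_product Q (map ns [1..<Suc k]) A"
  then obtain As where As: "A = mat_prod_list As" "list_all2 Q As (map ns [1..<Suc k])"
    by (auto simp: is_product_def)
  define E where "E i = As ! (i - 1)" for i
  have len: "length As = k" using list_all2_lengthD[OF As(2)] by simp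
  have "map E [1..<Suc k] = As"
    by (rule nth_equalityI) (simp_all add: len E_def del: upt_Suc)
  moreover have "Q (E i) (ns i)" if "i \<in> {1..k}" for i
  proof -
    have "i - 1 < length As" using that len by auto
    then have "Q (As ! (i - 1)) (map ns [1..<Suc k] ! (i - 1))"
      using list_all2_nthD[OF As(2)] by blast
    moreover have "map ns [1..<Suc k] ! (i - 1) = ns i"
      using that by (subst nth_map) (auto simp: nth_upt simp del: upt_Suc)
    ultimately show ?thesis by (simp only: E_def)
  qed
  ultimately show "\<exists>E. A = mat_prod_list (map E [1..<Suc k]) \<and> (\<forall>i\<in>{1..k}. Q (E i) (ns i))"
    using As(1) by blast
next
  assume "\<exists>E. A = mat_prod_list (map E [1..<Suc k]) \<and> (\<forall>i\<in>{1..k}. Q (E i) (ns i))"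
  then obtain E where E: "A = mat_prod_list (map E [1..<Suc k])" "\<forall>i\<in>{1..k}. Q (E i) (ns i)" by blast
  have "list_all2 Q (map E [1..<Suc k]) (map ns [1..<Suc k])"
    using E(2) by (auto simp: list_all2_conv_all_nth simp del: upt_Suc)
  then show "is_product Q (map ns [1..<Suc k]) A" using E(1) unfolding is_product_def by blast
qed

theorem corollary7:
  fixes G :: "'a::field^'n^'n"
    and k l :: nat
    and ns ms :: "nat \<Rightarrow> nat"
    and cs :: "nat \<Rightarrow> 'a"
    and c :: 'a
  assumes "k \<ge> 1"
    and "\<forall>i\<in>{1..k}. cs i \<noteq> 0"
    and "c = inverse (\<Prod>i\<in>{1..k}. cs i)"
  shows "(\<exists>E Z :: nat \<Rightarrow> 'a^'n^'n.
            G = mat_prod_list (map (\<lambda>i. mat_scale (cs i) (E i)) [1..<Suc k])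
                ** mat_prod_list (map Z [1..<Suc l])
            \<and> (\<forall>i\<in>{1..k}. E i ** E i = E i \<and> nullity (E i) = ns i)
            \<and> (\<forall>j\<in>{1..l}. Z j ** Z j = 0 \<and> nullity (Z j) = ms j))
         \<longleftrightarrow>
         ((\<forall>i\<in>{1..k}. ns i \<le> nullity G) \<and> (\<forall>j\<in>{1..l}. ms j \<le> nullity G)
          \<and> (\<forall>j\<in>{1..l}. real (ms j) \<ge> real CARD('n) / 2)
          \<and> (l = 0 \<longrightarrow> col_rank (mat 1 - mat_scale c G) \<le> (\<Sum>i\<in>{1..k}. ns i))
          \<and> (l = 1 \<longrightarrow> vec.dim {x + y | x y. x \<in> col_space G \<and> y \<in> null_space G}
                         \<le> (\<Sum>i\<in>{1..k}. ns i) + ms 1)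
          \<and> (l = 2 \<longrightarrow> col_rank G \<le> (\<Sum>i\<in>{1..k}. ns i) + nullity0 G))"
proof -
  define C where "C = (\<Prod>i\<in>{1..k}. cs i)"
  have C: "C \<noteq> 0" using assms(2) by (simp add: C_def)
  have c: "c = inverse C" "c \<noteq> 0" using assms(3) C by (simp_all add: C_def)
  define H where "H = mat_scale c G"
  let ?ns = "map ns [1..<Suc k]" and ?ms = "map ms [1..<Suc l]"
  have inv: "null_space H = null_space G" "col_space H = col_space G"
    by (simp_all add: H_def c null_space_mat_scale col_space_mat_scale C)
  have prodC: "prod_list (map cs [1..<Suc k]) = C"
    unfolding C_def by (subst prod.distinct_set_conv_list[symmetric]) (auto intro: prod.cong)
  have scale: "G = mat_scale C P ** Q \<longleftrightarrow> H = P ** Q" for P Q :: "'a^'n^'n"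
  proof
    assume "G = mat_scale C P ** Q"
    then show "H = P ** Q"
      using C by (simp add: H_def c mat_scale_mult mat_scale_mat_scale) (simp add: matrix_eq mat_scale_mult_vector)
  next
    assume "H = P ** Q"
    then have "mat_scale C P ** Q = mat_scale C H" by (simp add: mat_scale_mult)
    then show "G = mat_scale C P ** Q"
      using C by (simp add: H_def c mat_scale_mat_scale) (simp add: matrix_eq mat_scale_mult_vector)
  qed
  have "(\<exists>E Z :: nat \<Rightarrow> 'a^'n^'n.
            G = mat_prod_list (map (\<lambda>i. mat_scale (cs i) (E i)) [1..<Suc k])
                ** mat_prod_list (map Z [1..<Suc l])
            \<and> (\<forall>i\<in>{1..k}. E i ** E i = E i \<and> nullity (E i) = ns i)
            \<and> (\<forall>j\<in>{1..l}. Z j ** Z j = 0 \<and> nullity (Z j) = ms j))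
     \<longleftrightarrow> (\<exists>P Q. H = P ** Q \<and> is_product idempotent_nullity ?ns P \<and> is_product square_zero_nullity ?ms Q)"
    unfolding is_product_indexed mat_prod_list_scale prodC scale
      idempotent_nullity_def square_zero_nullity_def by blast
  also have "\<dots> \<longleftrightarrow> ((\<forall>i\<in>{1..k}. ns i \<le> nullity G) \<and> (\<forall>j\<in>{1..l}. ms j \<le> nullity G)
          \<and> (\<forall>j\<in>{1..l}. real (ms j) \<ge> real CARD('n) / 2)
          \<and> (l = 0 \<longrightarrow> col_rank (mat 1 - mat_scale c G) \<le> (\<Sum>i\<in>{1..k}. ns i))
          \<and> (l = 1 \<longrightarrow> vec.dim {x + y | x y. x \<in> col_space G \<and> y \<in> null_space G}
                         \<le> (\<Sum>i\<in>{1..k}. ns i) + ms 1)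
          \<and> (l = 2 \<longrightarrow> col_rank G \<le> (\<Sum>i\<in>{1..k}. ns i) + nullity0 G))"
  proof -
    have sums: "sum_list ?ns = (\<Sum>i\<in>{1..k}. ns i)"
      by (subst sum.distinct_set_conv_list[symmetric]) (auto intro: sum.cong)
    have sets: "set ?ns = ns ` {1..k}" "set ?ms = ms ` {1..l}" "length ?ms = l" by auto
    have half: "CARD('n) \<le> 2 * m \<longleftrightarrow> real m \<ge> real CARD('n) / 2" for m by linarith
    have first: "l = 1 \<Longrightarrow> ?ms ! 0 = ms 1" by simp
    show ?thesis
      unfolding product_idempotent_square_zero_iff sums sets half
      using first by (auto simp: inv nullity_def nullity0_def col_rank_def subspace_sum_def
          simp flip: H_def)
  qed
  finally show ?thesis .
qed

end
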